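(* For every algorithm $\mathbf{ALG}$ for the Repeated Prophet Inequality (in either the value-oblivious or the value-observed variant), $\mathrm{perf}(\mathbf{ALG}) \le 0.502$; that is, $\sup_{\mathbf{ALG}} \mathrm{perf}(\mathbf{ALG}) \le 0.502$.
   Context: Repeated Prophet Inequality. An adversary chooses $2n$ items with values $v_1 \ge v_2 \ge \dots \ge v_{2n} \ge 0$ (the instance $\bm v$), and $\sigma$ is a uniformly random permutation of $\{1,\dots,2n\}$. In Phase 1 the items $v_{\sigma(1)},\dots,v_{\sigma(n)}$ are presented one by one to a decision maker (DM); in Phase 2 the items $v_{\sigma(n+1)},\dots,v_{\sigma(2n)}$ are presented one by one. When an item arrives, the DM does not see its numerical value but learns its relative ranking among all items revealed to her so far (in both phases; ties are broken by an arbitrary rule, fixed and public in advance, consistent with the relative ranks revealed). She must then irrevocably accept it, which ends the current phase (no more items of that phase are revealed), or reject it forever and proceed to the next item of the phase, if any. When she accepts an item its value is not revealed. If no item is accepted in a phase, she gets value $0$ in that phase. In the value-observed variant the DM knows the list $v_1,\dots,v_{2n}$ in advance (but still only sees relative rankings when items arrive); in the value-oblivious variant she does not. An algorithm is a family $\mathbf{ALG} = (\mathrm{ALG}_n)_{n\in\mathbb{N}}$, where $\mathrm{ALG}_n$ describes how the DM (who knows $n$) acts on instances with $2n$ items; $\mathrm{ALG}_n(\bm v)$ denotes the random sum of the values accepted in the two phases. Its limit performance is $$\mathrm{perf}(\mathbf{ALG}) = \liminf_{n\to\infty} \inf_{\bm v} \frac{\mathbb{E}(\mathrm{ALG}_n(\bm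 v))}{\mathbb{E}\left(\max\{v_{\sigma(i)} : 1\le i\le n\} + \max\{v_{\sigma(i)} : n+1\le i\le 2n\}\right)},$$ the infimum being over instances of $2n$ items for which the ratio is defined (not all values zero). *)

theory Defs
  imports "HOL-Probability.Probability" "HOL-Combinatorics.Permutations"
begin

text \<open>
  Items and arrival times are indexed by \<open>{..<2 * n}\<close>: item \<open>i\<close> has value \<open>v ! i\<close> and
  the item arriving at time \<open>t\<close> is \<open>\<sigma> t\<close>. Phase 1 consists of the times \<open>{..<n}\<close>,
  Phase 2 of the times \<open>{n..<2 * n}\<close>.
\<close>

definition instances :: "nat \<Rightarrow> real list set" where
  "instances n = {v. length v = 2 * n \<and> sorted_wrt (\<ge>) v \<and> (\<forall>x\<in>set v. 0 \<le> x)}"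

definition arrival_orders :: "nat \<Rightarrow> (nat \<Rightarrow> nat) set" where
  "arrival_orders n = {\<sigma>. \<sigma> permutes {..<2 * n}}"

text \<open>
  If the items revealed so far are \<open>as\<close> in Phase 1 and \<open>bs\<close> in Phase 2, in order of arrival,
  then \<open>\<rho> n v as bs\<close> is the relative rank (1 is best) announced for the newest one,
  \<open>last (as @ bs)\<close>. The bounds say that \<open>\<rho>\<close> respects the values; they determine it
  when there are no ties, and otherwise \<open>\<rho>\<close> is an arbitrary tie-breaking rule.
  It may depend on the whole revealed past, and it is automatically consistent with the ranks
  announced earlier, since any sequence of relative ranks describes exactly one linear order of
  the revealed items.
\<close>

type_synonym ranking_rule = "nat \<Rightarrow> real list \<Rightarrow> nat list \<Rightarrow> nat list \<Rightarrow> nat"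

definition valid_ranking_rule :: "ranking_rule \<Rightarrow> bool" where
  "valid_ranking_rule \<rho> \<longleftrightarrow>
    (\<forall>n. \<forall>v\<in>instances n. \<forall>as bs.
      as @ bs \<noteq> [] \<and> distinct (as @ bs) \<and> set (as @ bs) \<subseteq> {..<2 * n} \<longrightarrow>
      (let x = last (as @ bs); earlier = set (butlast (as @ bs)) in
        card {y \<in> earlier. v ! y > v ! x} + 1 \<le> \<rho> n v as bs \<and>
        \<rho> n v as bs \<le> card {y \<in> earlier. v ! y \<ge> v ! x} + 1))"

lemma valid_ranking_rule_exists: "\<exists>\<rho>. valid_ranking_rule \<rho>"
proof
  show "valid_ranking_rule
    (\<lambda>n v as bs. card {y \<in> set (butlast (as @ bs)). v ! y > v ! last (as @ bs)} + 1)"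
    unfolding valid_ranking_rule_def Let_def by (auto intro!: card_mono)
qed

text \<open>The ranks seen by the decision maker while \<open>as\<close> (Phase 1), then \<open>bs\<close> (Phase 2), are
  revealed, for \<open>\<rho>\<close> already applied to \<open>n\<close> and \<open>v\<close>.\<close>

definition ranks1 :: "(nat list \<Rightarrow> nat list \<Rightarrow> nat) \<Rightarrow> nat list \<Rightarrow> nat list" where
  "ranks1 \<rho> as = map (\<lambda>k. \<rho> (take k as) []) [1..<Suc (length as)]"

definition ranks2 :: "(nat list \<Rightarrow> nat list \<Rightarrow> nat) \<Rightarrow> nat list \<Rightarrow> nat list \<Rightarrow> nat list" where
  "ranks2 \<rho> as bs = map (\<lambda>k. \<rho> as (take k bs)) [1..<Suc (length bs)]"

text \<open>
  A deterministic strategy: the first component decides, from the ranks seen so far in Phase 1,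
  whether to accept the current item; the second one does so in Phase 2, from all ranks seen in
  Phase 1 and the ranks seen so far in Phase 2. A (randomized) algorithm is a distribution over
  deterministic strategies, which allows any internal randomness, shared between the decisions.
\<close>

type_synonym strategy = "(nat list \<Rightarrow> bool) \<times> (nat list \<Rightarrow> nat list \<Rightarrow> bool)"

type_synonym value_oblivious_alg = "nat \<Rightarrow> strategy pmf"

type_synonym value_observed_alg = "nat \<Rightarrow> real list \<Rightarrow> strategy pmf"

text \<open>\<open>run_phase accept [] xs\<close> yields the items revealed and the item accepted, if any, when
  \<open>xs\<close> is presented and \<open>accept\<close> is asked on each list of items revealed so far.\<close>

fun run_phase :: "(nat list \<Rightarrow> bool) \<Rightarrow> nat list \<Rightarrow> nat list \<Rightarrow> nat list \<times> nat option" where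
  "run_phase accept seen [] = (seen, None)"
| "run_phase accept seen (x # xs) =
    (if accept (seen @ [x]) then (seen @ [x], Some x) else run_phase accept (seen @ [x]) xs)"

definition accepted_value :: "real list \<Rightarrow> nat option \<Rightarrow> real" where
  "accepted_value v c = (case c of None \<Rightarrow> 0 | Some i \<Rightarrow> v ! i)"

definition reward :: "ranking_rule \<Rightarrow> nat \<Rightarrow> real list \<Rightarrow> (nat \<Rightarrow> nat) \<Rightarrow> strategy \<Rightarrow> real" where
  "reward \<rho> n v \<sigma> s =
    (let (as, c1) = run_phase (\<lambda>xs. fst s (ranks1 (\<rho> n v) xs)) [] (map \<sigma> [0..<n]);
         (bs, c2) = run_phase (\<lambda>ys. snd s (ranks1 (\<rho> n v) as) (ranks2 (\<rho> n v) as ys)) []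
                      (map \<sigma> [n..<2 * n])
     in accepted_value v c1 + accepted_value v c2)"

definition expected_reward :: "ranking_rule \<Rightarrow> value_observed_alg \<Rightarrow> nat \<Rightarrow> real list \<Rightarrow> real" where
  "expected_reward \<rho> ALG n v =
    measure_pmf.expectation (pair_pmf (pmf_of_set (arrival_orders n)) (ALG n v))
      (\<lambda>(\<sigma>, s). reward \<rho> n v \<sigma> s)"

definition expected_optimum :: "nat \<Rightarrow> real list \<Rightarrow> real" where
  "expected_optimum n v =
    measure_pmf.expectation (pmf_of_set (arrival_orders n))
      (\<lambda>\<sigma>. Max ((\<lambda>i. v ! \<sigma> i) ` {..<n}) + Max ((\<lambda>i. v ! \<sigma> i) ` {n..<2 * n}))"

definition perf :: "ranking_rule \<Rightarrow> value_observed_alg \<Rightarrow> ereal" where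
  "perf \<rho> ALG =
    liminf (\<lambda>n. INF v \<in> {v \<in> instances n. \<exists>x\<in>set v. x \<noteq> 0}.
      ereal (expected_reward \<rho> ALG n v / expected_optimum n v))"

abbreviation perf_oblivious :: "ranking_rule \<Rightarrow> value_oblivious_alg \<Rightarrow> ereal" where
  "perf_oblivious \<rho> ALG \<equiv> perf \<rho> (\<lambda>n v. ALG n)"

end

theory Submission
  imports Defs
begin

text \<open>
  On an instance whose best item has value 1 while all others have tiny, pairwise distinct
  values, the reward is essentially the indicator of ever accepting the best item, and ranks are
  independent of the tie-breaking rule. If \<open>k\<close> positions have been revealed, the newest item is
  the best so far with probability \<open>1 / k\<close> whatever the earlier ranks were, and in that case it is
  the overall best with probability \<open>k / (2 * n)\<close>. So the probability of winning is the value of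
  an optimal stopping problem, which is bounded by exhibiting a potential for each phase
  (superharmonic functions). With \<open>t\<close> the fraction of items seen in Phase 1, Phase 2 is worth at most
  \<open>t * ln (1 + 1 / (2 * t))\<close>, or \<open>(t + 1 / 2) / e\<close> for small \<open>t\<close>, and the value of the
  whole game in the limit is about 0.5012.
\<close>

section \<open>Relative ranks in a uniformly random order\<close>

text \<open>One instance serves against every strategy, so knowing its values in advance cannot
  help, and a randomized algorithm is a mixture of the deterministic strategies to which the bound
  applies. No optimal policy is ever described. A strategy enters only through the probabilities of
  ending Phase 1 after \<open>q\<close> items and of accepting an item that is the best so far. The
  two facts on ranks become linear inequalities between these numbers, and the winning probability
  is linear in them. A superharmonic potential is then a feasible solution of the dual linear
  program: it has to be checked, not shown optimal. The obstacle is the Phase 1 potential. Its drift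
  condition contains the logarithmic value of Phase 2, so solving it exactly leads to a dilogarithm.
  Instead Phase 2 is bounded by tangents and the Phase 1 potential by a fitted elementary function.
  The gap between about 0.5012 and 0.502 pays for both, for the discretization and for the value of
  the small items.\<close>

definition same_order :: "nat \<Rightarrow> nat set \<Rightarrow> (nat \<Rightarrow> nat) \<Rightarrow> (nat \<Rightarrow> nat) \<Rightarrow> bool" where
  "same_order n S \<sigma> \<tau> \<longleftrightarrow> \<sigma> \<in> arrival_orders n \<and> \<tau> \<in> arrival_orders n \<and>
     (\<forall>x\<in>S. \<forall>y\<in>S. \<sigma> x < \<sigma> y \<longleftrightarrow> \<tau> x < \<tau> y)"

text \<open>An order maps positions to items, and smaller items are better. This is measurability of
  an event with respect to the relative order at the positions in \<open>S\<close>, encoded as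
  invariance so that counting orders suffices.\<close>

definition order_determined :: "nat \<Rightarrow> nat set \<Rightarrow> ((nat \<Rightarrow> nat) \<Rightarrow> bool) \<Rightarrow> bool" where
  "order_determined n S Q \<longleftrightarrow> (\<forall>\<sigma> \<tau>. same_order n S \<sigma> \<tau> \<longrightarrow> Q \<sigma> = Q \<tau>)"

definition position_rank :: "nat set \<Rightarrow> (nat \<Rightarrow> nat) \<Rightarrow> nat \<Rightarrow> nat" where
  "position_rank S \<sigma> x = card {z \<in> S. \<sigma> z < \<sigma> x}"

definition prob_order :: "nat \<Rightarrow> ((nat \<Rightarrow> nat) \<Rightarrow> bool) \<Rightarrow> real" where
  "prob_order n Q = card {\<sigma> \<in> arrival_orders n. Q \<sigma>} / card (arrival_orders n)"

lemma finite_arrival_orders [simp]: "finite (arrival_orders n)"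
  by (simp add: arrival_orders_def finite_permutations)

lemma card_arrival_orders_pos: "0 < card (arrival_orders n)"
proof -
  have "id \<in> arrival_orders n"
    by (simp add: arrival_orders_def permutes_id)
  then show ?thesis
    by (auto simp: card_gt_0_iff)
qed

lemma arrival_orders_nonempty [simp]: "arrival_orders n \<noteq> {}"
  using card_arrival_orders_pos[of n] by auto

lemma inj_arrival_orders: "\<sigma> \<in> arrival_orders n \<Longrightarrow> inj \<sigma>"
  by (auto simp: arrival_orders_def permutes_inj)

lemma order_determined_mono:
  assumes "order_determined n S Q" "S \<subseteq> S'"
  shows "order_determined n S' Q"
proof -
  have "same_order n S' \<sigma> \<tau> \<Longrightarrow> same_order n S \<sigma> \<tau>" for \<sigma> \<tau>
    using assms(2) by (auto simp: same_order_def)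
  then show ?thesis
    using assms(1) by (simp add: order_determined_def)
qed

lemma order_determined_conj:
  "order_determined n S Q \<Longrightarrow> order_determined n S R \<Longrightarrow> order_determined n S (\<lambda>\<sigma>. Q \<sigma> \<and> R \<sigma>)"
  by (simp add: order_determined_def)

lemma order_determined_disj:
  "order_determined n S Q \<Longrightarrow> order_determined n S R \<Longrightarrow> order_determined n S (\<lambda>\<sigma>. Q \<sigma> \<or> R \<sigma>)"
  by (simp add: order_determined_def)

lemma order_determined_not:
  "order_determined n S Q \<Longrightarrow> order_determined n S (\<lambda>\<sigma>. \<not> Q \<sigma>)"
  by (simp add: order_determined_def)

lemma order_determined_ball:
  "(\<And>j. j \<in> J \<Longrightarrow> order_determined n S (Q j)) \<Longrightarrow> order_determined n S (\<lambda>\<sigma>. \<forall>j\<in>J. Q j \<sigma>)"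
  unfolding order_determined_def by blast

lemma order_determined_const: "order_determined n S (\<lambda>_. b)"
  by (simp add: order_determined_def)

lemma order_determined_less:
  "x \<in> S \<Longrightarrow> y \<in> S \<Longrightarrow> order_determined n S (\<lambda>\<sigma>. \<sigma> x < \<sigma> y)"
  by (simp add: order_determined_def same_order_def)

lemma position_rank_less_iff:
  assumes "finite S" "x \<in> S"
  shows "position_rank S \<sigma> x < position_rank S \<sigma> y \<longleftrightarrow> \<sigma> x < \<sigma> y"
proof
  assume "\<sigma> x < \<sigma> y"
  then have "{z \<in> S. \<sigma> z < \<sigma> x} \<subset> {z \<in> S. \<sigma> z < \<sigma> y}"
    using assms by auto
  then show "position_rank S \<sigma> x < position_rank S \<sigma> y"
    unfolding position_rank_def using assms by (intro psubset_card_mono) auto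
next
  assume "position_rank S \<sigma> x < position_rank S \<sigma> y"
  then show "\<sigma> x < \<sigma> y"
    unfolding position_rank_def
    by (rule contrapos_pp) (use assms in \<open>auto intro!: card_mono simp: not_less\<close>)
qed

lemma bij_betw_position_rank:
  assumes "finite S" "inj \<sigma>"
  shows "bij_betw (position_rank S \<sigma>) S {..<card S}"
proof -
  have "inj_on (position_rank S \<sigma>) S"
    using assms position_rank_less_iff[OF assms(1)]
    by (intro inj_onI) (metis injD less_irrefl linorder_neqE_nat)
  moreover have "position_rank S \<sigma> x < card S" if "x \<in> S" for x
    unfolding position_rank_def using that assms by (intro psubset_card_mono) auto
  ultimately show ?thesis
    using assms by (metis (no_types, lifting) card_image card_lessThan card_subset_eq finite_lessThan
        bij_betw_def image_subsetI lessThan_iff)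
qed

lemma position_rank_transpose:
  assumes "p \<in> S" "x \<in> S"
  shows "position_rank S (\<sigma> \<circ> Transposition.transpose p x) y = position_rank S \<sigma> (Transposition.transpose p x y)"
proof -
  let ?t = "Transposition.transpose p x"
  have "{z \<in> S. (\<sigma> \<circ> ?t) z < (\<sigma> \<circ> ?t) y} = ?t ` {z \<in> S. \<sigma> z < \<sigma> (?t y)}"
    using assms by (auto simp: image_iff Transposition.transpose_def)
  then show ?thesis
    unfolding position_rank_def by (simp add: card_image inj_on_subset[OF inj_transpose])
qed

text \<open>Moving \<open>p\<close> past the position of adjacent rank is a bijection that does not
  change the order of the other positions.\<close>

lemma card_position_rank_Suc:
  assumes "finite S" "S \<subseteq> {..<2 * n}" "p \<in> S" "order_determined n (S - {p}) Q" "Suc r < card S"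
  shows "card {\<sigma> \<in> arrival_orders n. Q \<sigma> \<and> position_rank S \<sigma> p = Suc r}
       = card {\<sigma> \<in> arrival_orders n. Q \<sigma> \<and> position_rank S \<sigma> p = r}"
proof -
  define pos where "pos j \<sigma> = inv_into S (position_rank S \<sigma>) j" for j \<sigma>
  define f where "f j \<sigma> = \<sigma> \<circ> Transposition.transpose p (pos j \<sigma>)" for j \<sigma>
  let ?E = "\<lambda>i. {\<sigma> \<in> arrival_orders n. Q \<sigma> \<and> position_rank S \<sigma> p = i}"
  have pos: "pos j \<sigma> \<in> S" "position_rank S \<sigma> (pos j \<sigma>) = j"
    if "\<sigma> \<in> arrival_orders n" "j < card S" for j \<sigma>
    using bij_betw_position_rank[OF assms(1) inj_arrival_orders[OF that(1)]] that(2)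
    unfolding pos_def by (auto simp: bij_betw_def intro: inv_into_into f_inv_into_f)
  have pos_eq: "pos j \<sigma> = x" if "\<sigma> \<in> arrival_orders n" "x \<in> S" "position_rank S \<sigma> x = j" for j \<sigma> x
    using bij_betw_position_rank[OF assms(1) inj_arrival_orders[OF that(1)]] that
    unfolding pos_def by (auto simp: bij_betw_def)
  have swap: "f j \<sigma> \<in> ?E j \<and> f i (f j \<sigma>) = \<sigma>"
    if \<sigma>: "\<sigma> \<in> ?E i" and ij: "i < card S" "j < card S" "i = Suc j \<or> j = Suc i" for i j \<sigma>
  proof -
    let ?x = "pos j \<sigma>"
    let ?t = "Transposition.transpose p ?x"
    have x: "?x \<in> S" "position_rank S \<sigma> ?x = j" using pos \<sigma> ij by auto
    have in_orders: "f j \<sigma> \<in> arrival_orders n"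
      using \<sigma> x assms(2,3) unfolding f_def arrival_orders_def
      by (auto intro!: permutes_compose permutes_swap_id)
    have rank: "position_rank S (f j \<sigma>) y = position_rank S \<sigma> (?t y)" for y
      unfolding f_def using position_rank_transpose[OF assms(3) x(1)] .
    have inj: "position_rank S \<sigma> y \<noteq> position_rank S \<sigma> z" if "y \<in> S" "z \<in> S" "y \<noteq> z" for y z
      using bij_betw_position_rank[OF assms(1) inj_arrival_orders[of \<sigma> n]] \<sigma> that
      by (auto simp: bij_betw_def inj_on_def)
    have rank_p: "position_rank S \<sigma> p = i" using \<sigma> by auto
    \<comment> \<open>Apart from \<open>p\<close>, only \<open>?x\<close> changes its rank, from
      \<open>j\<close> to \<open>i\<close>. These ranks are adjacent, so no third position lies
      between them and no comparison away from \<open>p\<close> flips.\<close>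
    have same: "\<sigma> y < \<sigma> z \<longleftrightarrow> f j \<sigma> y < f j \<sigma> z" if yz: "y \<in> S - {p}" "z \<in> S - {p}" for y z
    proof -
      have S: "y \<in> S" "z \<in> S" "y \<noteq> p" "z \<noteq> p" using yz by auto
      have "\<sigma> y < \<sigma> z \<longleftrightarrow> position_rank S \<sigma> y < position_rank S \<sigma> z"
        using position_rank_less_iff[OF assms(1)] S by simp
      also have "\<dots> \<longleftrightarrow> position_rank S \<sigma> (?t y) < position_rank S \<sigma> (?t z)"
        using inj[OF S(1) assms(3)] inj[OF S(2) assms(3)] inj[OF S(1) x(1)] inj[OF S(2) x(1)]
          S x(2) rank_p ij(3) by (auto simp: Transposition.transpose_def)
      also have "\<dots> \<longleftrightarrow> f j \<sigma> y < f j \<sigma> z"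
        using position_rank_less_iff[OF assms(1) S(1)] by (simp flip: rank)
      finally show ?thesis .
    qed
    have "same_order n (S - {p}) \<sigma> (f j \<sigma>)"
      unfolding same_order_def using same \<sigma> in_orders by blast
    then have "Q (f j \<sigma>) = Q \<sigma>"
      using assms(4) by (simp add: order_determined_def)
    moreover have "position_rank S (f j \<sigma>) p = j" by (simp add: rank x)
    moreover have "pos i (f j \<sigma>) = ?x"
      using in_orders x(1) rank_p by (intro pos_eq) (simp_all add: rank)
    ultimately show ?thesis
      using \<sigma> in_orders unfolding f_def[of i] by (auto simp: f_def comp_assoc)
  qed
  have "bij_betw (f r) (?E (Suc r)) (?E r)"
  proof (rule bij_betw_byWitness[where f' = "f (Suc r)"])
    show "\<forall>\<sigma>\<in>?E (Suc r). f (Suc r) (f r \<sigma>) = \<sigma>" "f r ` ?E (Suc r) \<subseteq> ?E r"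
      using swap[of _ "Suc r" r] assms(5) by auto
    show "\<forall>\<sigma>\<in>?E r. f r (f (Suc r) \<sigma>) = \<sigma>" "f (Suc r) ` ?E r \<subseteq> ?E (Suc r)"
      using swap[of _ r "Suc r"] assms(5) by auto
  qed
  then show ?thesis by (rule bij_betw_same_card)
qed

text \<open>By the swap, each of the \<open>card S\<close> possible ranks of \<open>p\<close> occurs
  for equally many orders satisfying \<open>Q\<close>, and rank 0 is the best.\<close>

lemma card_best_position:
  assumes "finite S" "S \<subseteq> {..<2 * n}" "p \<in> S" "order_determined n (S - {p}) Q"
  shows "card S * card {\<sigma> \<in> arrival_orders n. Q \<sigma> \<and> (\<forall>x\<in>S. \<sigma> p \<le> \<sigma> x)}
       = card {\<sigma> \<in> arrival_orders n. Q \<sigma>}"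
proof -
  let ?E = "\<lambda>r. {\<sigma> \<in> arrival_orders n. Q \<sigma> \<and> position_rank S \<sigma> p = r}"
  have const: "card (?E r) = card (?E 0)" if "r < card S" for r
    using that
  proof (induction r)
    case (Suc r)
    then show ?case using card_position_rank_Suc[OF assms Suc.prems] by simp
  qed simp
  have lt: "position_rank S \<sigma> p < card S" if "\<sigma> \<in> arrival_orders n" for \<sigma>
    using bij_betw_position_rank[OF assms(1) inj_arrival_orders[OF that]] assms(3)
    by (auto simp: bij_betw_def)
  have "{\<sigma> \<in> arrival_orders n. Q \<sigma>} = (\<Union>r\<in>{..<card S}. ?E r)"
    using lt by auto
  then have "card {\<sigma> \<in> arrival_orders n. Q \<sigma>} = (\<Sum>r<card S. card (?E r))"
    by (simp only:) (subst card_UN_disjoint; auto)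
  also have "\<dots> = (\<Sum>r<card S. card (?E 0))"
    by (rule sum.cong[OF refl], rule const) simp
  also have "\<dots> = card S * card (?E 0)" by simp
  also have "?E 0 = {\<sigma> \<in> arrival_orders n. Q \<sigma> \<and> (\<forall>x\<in>S. \<sigma> p \<le> \<sigma> x)}"
    using assms(1) by (auto simp: position_rank_def not_less)
  finally show ?thesis by simp
qed

text \<open>Revealing one more position keeps \<open>p\<close> in the lead with probability \<open>k / (k + 1)\<close>,
  where \<open>k = card S\<close>; these factors telescope.\<close>

lemma card_overall_best:
  assumes "S \<subseteq> {..<2 * n}" "p \<in> S" "order_determined n S Q"
    and "\<And>\<sigma> x. \<sigma> \<in> arrival_orders n \<Longrightarrow> Q \<sigma> \<Longrightarrow> x \<in> S \<Longrightarrow> \<sigma> p \<le> \<sigma> x"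
  shows "2 * n * card {\<sigma> \<in> arrival_orders n. Q \<sigma> \<and> \<sigma> p = 0}
       = card S * card {\<sigma> \<in> arrival_orders n. Q \<sigma>}"
  using assms
proof (induction "2 * n - card S" arbitrary: S Q rule: less_induct)
  case less
  have fin: "finite S" using less.prems(1) finite_subset by blast
  show ?case
  proof (cases "S = {..<2 * n}")
    case True
    have "\<sigma> p = 0" if "\<sigma> \<in> arrival_orders n" "Q \<sigma>" for \<sigma>
    proof -
      have "0 \<in> \<sigma> ` {..<2 * n}"
        using that less.prems(2) True by (simp add: arrival_orders_def permutes_image)
      then show ?thesis using less.prems(4)[OF that] True by fastforce
    qed
    then have "{\<sigma> \<in> arrival_orders n. Q \<sigma> \<and> \<sigma> p = 0} = {\<sigma> \<in> arrival_orders n. Q \<sigma>}" by auto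
    then show ?thesis using True by simp
  next
    case False
    then obtain z where z: "z \<in> {..<2 * n}" "z \<notin> S" using less.prems(1) by blast
    let ?S = "insert z S" and ?Q = "\<lambda>\<sigma>. Q \<sigma> \<and> \<sigma> p < \<sigma> z"
    have pz: "p \<noteq> z" using z less.prems by auto
    have neq: "\<sigma> p \<noteq> \<sigma> z" if "\<sigma> \<in> arrival_orders n" for \<sigma>
      using inj_arrival_orders[OF that] pz by (auto dest: injD)
    have S: "?S \<subseteq> {..<2 * n}" "card ?S = Suc (card S)"
      using z less.prems(1) fin by auto
    have "card ?S \<le> 2 * n" using S(1) card_mono[of "{..<2 * n}" ?S] by simp
    then have "2 * n * card {\<sigma> \<in> arrival_orders n. ?Q \<sigma> \<and> \<sigma> p = 0}
        = card ?S * card {\<sigma> \<in> arrival_orders n. ?Q \<sigma>}"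
      using S less.prems
      by (intro less.hyps order_determined_conj order_determined_less)
        (auto intro: order_determined_mono)
    moreover have "{\<sigma> \<in> arrival_orders n. ?Q \<sigma> \<and> \<sigma> p = 0} = {\<sigma> \<in> arrival_orders n. Q \<sigma> \<and> \<sigma> p = 0}"
      using neq by (intro Collect_cong) (metis gr_zeroI)
    moreover have "card ?S * card {\<sigma> \<in> arrival_orders n. Q \<sigma> \<and> (\<forall>x\<in>?S. \<sigma> z \<le> \<sigma> x)}
        = card {\<sigma> \<in> arrival_orders n. Q \<sigma>}"
      using z S less.prems fin by (intro card_best_position) auto
    \<comment> \<open>On \<open>Q\<close> the position \<open>p\<close> leads \<open>S\<close>, so
      \<open>z\<close> either falls behind \<open>p\<close> or becomes the best of
      \<open>?S\<close>. The fact just shown counts the second case.\<close>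
    moreover have "card {\<sigma> \<in> arrival_orders n. Q \<sigma>}
        = card {\<sigma> \<in> arrival_orders n. ?Q \<sigma>}
        + card {\<sigma> \<in> arrival_orders n. Q \<sigma> \<and> (\<forall>x\<in>?S. \<sigma> z \<le> \<sigma> x)}"
    proof -
      have "{\<sigma> \<in> arrival_orders n. Q \<sigma>} = {\<sigma> \<in> arrival_orders n. ?Q \<sigma>}
          \<union> {\<sigma> \<in> arrival_orders n. Q \<sigma> \<and> (\<forall>x\<in>?S. \<sigma> z \<le> \<sigma> x)}"
        using less.prems(2,4) neq by (auto simp: not_less intro: less_imp_le order_trans)
      moreover have "{\<sigma> \<in> arrival_orders n. ?Q \<sigma>}
          \<inter> {\<sigma> \<in> arrival_orders n. Q \<sigma> \<and> (\<forall>x\<in>?S. \<sigma> z \<le> \<sigma> x)} = {}"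
        using less.prems(2) by auto
      ultimately show ?thesis by (simp add: card_Un_disjoint)
    qed
    ultimately show ?thesis using S(2) by (simp add: algebra_simps)
  qed
qed

lemma prob_order_nonneg: "0 \<le> prob_order n Q"
  by (simp add: prob_order_def)

lemma prob_order_mono:
  "(\<And>\<sigma>. \<sigma> \<in> arrival_orders n \<Longrightarrow> Q \<sigma> \<Longrightarrow> R \<sigma>) \<Longrightarrow> prob_order n Q \<le> prob_order n R"
  unfolding prob_order_def by (intro divide_right_mono of_nat_mono card_mono) auto

lemma prob_order_True: "prob_order n (\<lambda>_. True) = 1"
  by (simp add: prob_order_def)

lemma prob_order_split:
  assumes "\<And>\<sigma>. \<sigma> \<in> arrival_orders n \<Longrightarrow> Q \<sigma> \<longleftrightarrow> R \<sigma> \<or> R' \<sigma>"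
    and "\<And>\<sigma>. \<sigma> \<in> arrival_orders n \<Longrightarrow> \<not> (R \<sigma> \<and> R' \<sigma>)"
  shows "prob_order n Q = prob_order n R + prob_order n R'"
proof -
  have "{\<sigma> \<in> arrival_orders n. Q \<sigma>} = {\<sigma> \<in> arrival_orders n. R \<sigma>} \<union> {\<sigma> \<in> arrival_orders n. R' \<sigma>}"
    using assms(1) by auto
  moreover have "{\<sigma> \<in> arrival_orders n. R \<sigma>} \<inter> {\<sigma> \<in> arrival_orders n. R' \<sigma>} = {}"
    using assms(2) by auto
  ultimately show ?thesis
    by (simp add: prob_order_def card_Un_disjoint add_divide_distrib)
qed

lemma prob_best_position:
  assumes "finite S" "S \<subseteq> {..<2 * n}" "p \<in> S" "order_determined n (S - {p}) Q"
  shows "card S * prob_order n (\<lambda>\<sigma>. Q \<sigma> \<and> (\<forall>x\<in>S. \<sigma> p \<le> \<sigma> x)) = prob_order n Q"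
  using card_best_position[OF assms] by (simp add: prob_order_def flip: of_nat_mult)

lemma prob_overall_best:
  assumes "S \<subseteq> {..<2 * n}" "p \<in> S" "order_determined n S Q"
  shows "2 * n * prob_order n (\<lambda>\<sigma>. Q \<sigma> \<and> \<sigma> p = 0)
       = card S * prob_order n (\<lambda>\<sigma>. Q \<sigma> \<and> (\<forall>x\<in>S. \<sigma> p \<le> \<sigma> x))"
proof -
  have "order_determined n S (\<lambda>\<sigma>. Q \<sigma> \<and> (\<forall>x\<in>S. \<not> \<sigma> x < \<sigma> p))"
    using assms by (intro order_determined_conj order_determined_ball order_determined_not
        order_determined_less) auto
  then have "2 * n * card {\<sigma> \<in> arrival_orders n. (Q \<sigma> \<and> (\<forall>x\<in>S. \<sigma> p \<le> \<sigma> x)) \<and> \<sigma> p = 0}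
     = card S * card {\<sigma> \<in> arrival_orders n. Q \<sigma> \<and> (\<forall>x\<in>S. \<sigma> p \<le> \<sigma> x)}"
    using assms by (intro card_overall_best) (auto simp: not_less)
  moreover have "{\<sigma> \<in> arrival_orders n. (Q \<sigma> \<and> (\<forall>x\<in>S. \<sigma> p \<le> \<sigma> x)) \<and> \<sigma> p = 0}
     = {\<sigma> \<in> arrival_orders n. Q \<sigma> \<and> \<sigma> p = 0}" by auto
  ultimately have "real (2 * n * card {\<sigma> \<in> arrival_orders n. Q \<sigma> \<and> \<sigma> p = 0})
     = real (card S * card {\<sigma> \<in> arrival_orders n. Q \<sigma> \<and> (\<forall>x\<in>S. \<sigma> p \<le> \<sigma> x)})"
    by simp
  then show ?thesis by (simp add: prob_order_def)
qed

section \<open>Potentials for the stopping problems\<close>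

lemma exp_ge_partial_sum: "(\<Sum>k<n. x ^ k / fact k) \<le> exp x" if "0 \<le> x" for x :: real
proof -
  have "summable (\<lambda>k. x ^ k /\<^sub>R fact k)"
    by (rule summable_exp_generic)
  then have "(\<Sum>k<n. x ^ k /\<^sub>R fact k) \<le> exp x"
    unfolding exp_def by (rule sum_le_suminf) (use that in auto)
  then show ?thesis
    by (simp add: divide_inverse mult.commute)
qed

lemma exp_minus_le:
  fixes x c :: real
  assumes "0 \<le> x" "0 < c" "1 \<le> c * (\<Sum>k<n. x ^ k / fact k)"
  shows "exp (- x) \<le> c"
proof -
  have "1 \<le> c * exp x"
    using assms exp_ge_partial_sum[OF assms(1), of n]
    by (meson mult_left_mono order_trans less_imp_le)
  then show ?thesis
    by (simp add: exp_minus field_simps)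
qed

text \<open>The exponents 1, 0.85 and 0.7 select the tangents to the value of Phase 2; the last
  bound gives \<open>ln 0.4646 \<ge> - 0.7666\<close>, for a tangent at
  \<open>t = 0.2323\<close>.\<close>

lemma exp_minus_bounds:
  "exp (- 1 :: real) \<le> 0.36788" "exp (- 0.85 :: real) \<le> 0.42742"
  "exp (- 0.7 :: real) \<le> 0.49659" "exp (- 0.7666 :: real) \<le> 0.4646"
  by (rule exp_minus_le[where n = 9]; simp add: eval_nat_numeral fact_Suc; fail)+

lemma ln_le_tangent: "ln z \<le> r - 1 + z * exp (- r)" if "0 < z" for z r :: real
proof -
  have "ln (z * exp (- r)) \<le> z * exp (- r) - 1"
    using that by (intro ln_le_minus_one) auto
  with that show ?thesis
    by (simp add: ln_mult)
qed

text \<open>The right-hand side is linear in \<open>x\<close> and touches the concave left-hand side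
  at \<open>x = T * exp (- r)\<close>; \<open>r = 1\<close> is the horizontal tangent.\<close>

lemma mult_ln_div_le: "x * ln (T / x) \<le> T * exp (- r) - (1 - r) * x"
  if "0 < x" "0 < T" for x T r :: real
proof -
  have "x * ln (T / x) \<le> x * (r - 1 + T / x * exp (- r))"
    using that by (intro mult_left_mono ln_le_tangent) auto
  also have "\<dots> = T * exp (- r) - (1 - r) * x"
    using that by (simp add: field_simps)
  finally show ?thesis .
qed

text \<open>Weak duality for one phase. \<open>Y\<close> minus the partial sum bounds the mass still
  in play, of which at most a fraction \<open>1 / w\<close> can stop at \<open>w\<close> on a best
  item, with gain proportional to \<open>w\<close>. Backward induction shows that the future gain is
  at most \<open>g p\<close> times the mass in play.\<close>

lemma stopping_potential_bound:
  fixes b g :: "nat \<Rightarrow> real"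
  assumes "q \<le> T"
    and b: "\<And>w. q < w \<Longrightarrow> w \<le> T \<Longrightarrow> 0 \<le> b w"
      "\<And>w. q < w \<Longrightarrow> w \<le> T \<Longrightarrow> w * b w \<le> Y - (\<Sum>u\<in>{q<..<w}. b u)"
    and "0 \<le> Y" "0 \<le> g T"
    and g: "\<And>w. q < w \<Longrightarrow> w \<le> T \<Longrightarrow> g w \<le> g (w - 1)"
      "\<And>w. q < w \<Longrightarrow> w \<le> T \<Longrightarrow> w + (w - 1) * g w \<le> w * g (w - 1)"
  shows "(\<Sum>w\<in>{q<..T}. w * b w) \<le> g q * Y"
proof -
  have rest: "0 \<le> Y - (\<Sum>u\<in>{q<..p}. b u)" if "q \<le> p" "p \<le> T" for p
  proof (cases "q = p")
    case True
    then show ?thesis using \<open>0 \<le> Y\<close> by simp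
  next
    case False
    with that have "q < p" by simp
    then have "{q<..p} = insert p {q<..<p}" by auto
    moreover have "b p \<le> p * b p"
      using b(1)[of p] \<open>q < p\<close> that(2) mult_right_mono[of 1 "real p" "b p"] by simp
    ultimately show ?thesis
      using b(2)[of p] \<open>q < p\<close> that(2) by simp
  qed
  have "(\<Sum>w\<in>{p<..T}. w * b w) \<le> g p * (Y - (\<Sum>u\<in>{q<..p}. b u))" if "q \<le> p" "p \<le> T" for p
    using that(2,1)
  proof (induction p rule: inc_induct)
    case base
    then show ?case using rest[of T] \<open>0 \<le> g T\<close> \<open>q \<le> T\<close> by simp
  next
    case (step p)
    let ?w = "Suc p" and ?R = "Y - (\<Sum>u\<in>{q<..p}. b u)"
    have eqs: "{p<..T} = insert ?w {?w<..T}" "{q<..?w} = insert ?w {q<..p}"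
      "{q<..<?w} = {q<..p}"
      using step by auto
    have R: "0 \<le> ?R" "0 \<le> b ?w" "?w * b ?w \<le> ?R"
      using rest[of p] step b[of ?w] eqs(3) by auto
    have gs: "g ?w \<le> g p" "?w + (?w - 1) * g ?w \<le> ?w * g p"
      using g[of ?w] step by auto
    have "(\<Sum>w\<in>{p<..T}. w * b w) = ?w * b ?w + (\<Sum>w\<in>{?w<..T}. w * b w)"
      unfolding eqs(1) by (subst sum.insert) auto
    also have "\<dots> \<le> ?w * b ?w + g ?w * (?R - b ?w)"
    proof -
      have "(\<Sum>w\<in>{?w<..T}. w * b w) \<le> g ?w * (Y - (\<Sum>u\<in>{q<..?w}. b u))"
        using step by simp
      then show ?thesis unfolding eqs(2) by (simp add: algebra_simps)
    qed
    also have "\<dots> \<le> g p * ?R"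
    proof -
      \<comment> \<open>Up to the factor \<open>?w\<close>, a mixture of the two conditions on
        \<open>g\<close>: the weight \<open>?w * b ?w\<close> gets the drift inequality, the
        remaining weight gets monotonicity.\<close>
      have "?w * (?w * b ?w + g ?w * (?R - b ?w)) = (?w * b ?w) * (?w + (?w - 1) * g ?w)
              + (?R - ?w * b ?w) * (?w * g ?w)"
        by (simp add: algebra_simps)
      also have "\<dots> \<le> (?w * b ?w) * (?w * g p) + (?R - ?w * b ?w) * (?w * g p)"
        using R gs by (intro add_mono mult_left_mono) (auto simp del: of_nat_Suc)
      also have "\<dots> = ?w * (g p * ?R)"
        by (simp add: algebra_simps)
      finally show ?thesis
        by (simp del: of_nat_Suc)
    qed
    finally show ?case .
  qed
  from this[of q] show ?thesis using \<open>q \<le> T\<close> by simp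
qed

text \<open>Here \<open>b w\<close> is the probability of stopping at the \<open>w\<close>-th revealed item when it is the best
  so far. The potential is the continuous one, constant before the threshold \<open>T / e\<close> and
  \<open>w * ln (T / w)\<close> after it, shifted by one to absorb the discretization.\<close>

lemma single_phase_bound:
  fixes b :: "nat \<Rightarrow> real" and r Y :: real
  assumes "1 \<le> q" "q \<le> T" "r \<le> 1" "0 \<le> r"
    and b: "\<And>w. q < w \<Longrightarrow> w \<le> T \<Longrightarrow> 0 \<le> b w"
      "\<And>w. q < w \<Longrightarrow> w \<le> T \<Longrightarrow> w * b w \<le> Y - (\<Sum>u\<in>{q<..<w}. b u)"
    and "0 \<le> Y"
  shows "(\<Sum>w\<in>{q<..T}. w * b w) \<le> (2 + T * exp (- r) - (1 - r) * q) * Y"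
proof -
  define c where "c = T * exp (- 1) + (1 :: real)"
  define g where "g w = (if real w \<le> c then c else w * ln (T / (real w - 1)))" for w
  have T: "0 < real T" and c: "1 < c"
    using assms(1,2) by (auto simp: c_def)
  have ln1: "ln (T / x) \<le> 1" if "T * exp (- 1) \<le> x" for x :: real
  proof -
    have x: "0 < x" using that T by (smt (verit) mult_pos_pos exp_gt_zero)
    have "T / x \<le> exp 1"
      using that x by (simp add: exp_minus field_simps)
    then show ?thesis using x T by (metis divide_pos_pos exp_gt_zero ln_exp ln_le_cancel_iff)
  qed
  have pot: "g w \<le> g (w - 1) \<and> w + (real w - 1) * g w \<le> w * g (w - 1)"
    if "q < w" "w \<le> T" for w
  proof -
    have w: "real (w - 1) = real w - 1" "1 < real w"
      using that assms(1) by auto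
    consider "real w \<le> c" | "real w > c" "real w - 1 \<le> c" | "real w - 1 > c"
      by linarith
    then show ?thesis
    proof cases
      case 1
      then show ?thesis using w by (simp add: g_def algebra_simps)
    next
      case 2
      then have x: "real w - 1 > T * exp (- 1)" by (simp add: c_def)
      have le: "(real w - 1) * ln (T / (real w - 1)) \<le> T * exp (- 1)"
        using mult_ln_div_le[of "real w - 1" T 1] w T by simp
      have gw: "g w = (real w - 1) * ln (T / (real w - 1)) + ln (T / (real w - 1))"
        using 2 by (simp add: g_def algebra_simps)
      have gc: "g w \<le> c"
        using le ln1[of "real w - 1"] x by (simp add: gw c_def)
      have "w + (real w - 1) * g w = w * (1 + (real w - 1) * ln (T / (real w - 1)))"
        using 2 by (simp add: g_def algebra_simps)
      also have "\<dots> \<le> w * c"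
        using le by (intro mult_left_mono) (auto simp: c_def)
      finally show ?thesis using 2 w gc by (simp add: g_def)
    next
      case 3
      then have x: "real w - 1 > T * exp (- 1)" "real w - 2 > 0"
        using c by (simp_all add: c_def)
      let ?L = "\<lambda>x. ln (T / (x - 1)) :: real"
      have step: "1 \<le> (real w - 1) * (?L (real w - 1) - ?L w)"
      proof -
        have "?L w - ?L (real w - 1) = ln ((real w - 2) / (real w - 1))"
          using x T by (simp add: ln_div)
        also have "\<dots> \<le> (real w - 2) / (real w - 1) - 1"
          using x by (intro ln_le_minus_one) auto
        also have "\<dots> = - 1 / (real w - 1)"
          using x by (simp add: field_simps)
        finally have "1 / (real w - 1) \<le> ?L (real w - 1) - ?L w" by simp
        then show ?thesis using w(2) by (simp add: field_simps)
      qed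
      have gs: "g w = w * ?L w" "g (w - 1) = (real w - 1) * ?L (real w - 1)"
        using 3 w by (auto simp: g_def)
      have "g w \<le> g (w - 1)"
        using step ln1[of "real w - 1"] x by (simp add: gs algebra_simps del: One_nat_def)
      moreover have "w * 1 + (real w - 1) * g w \<le> w * g (w - 1)"
        using mult_left_mono[OF step, of "real w"] by (simp add: gs algebra_simps del: One_nat_def)
      ultimately show ?thesis by simp
    qed
  qed
  have "0 \<le> g T"
  proof -
    have "0 \<le> ln (T / (real T - 1))" if "c < T"
      using that c by (intro ln_ge_zero) (auto simp: field_simps)
    then show ?thesis using c by (simp add: g_def)
  qed
  then have "(\<Sum>w\<in>{q<..T}. w * b w) \<le> g q * Y"
    using assms pot by (intro stopping_potential_bound) auto
  \<comment> \<open>Both branches of \<open>g\<close> lie below every tangent, so the later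
    estimates need only linear bounds and no threshold. The constant 2 is made of one unit for the
    shift in \<open>g\<close> and at most \<open>1 - r\<close> for moving \<open>q\<close> by
    one.\<close>
  also have "g q \<le> 2 + T * exp (- r) - (1 - r) * q"
  proof (cases "real q \<le> c")
    case True
    have "(1 - r) * q \<le> (1 - r) * c"
      using True assms by (intro mult_left_mono) auto
    also have "\<dots> = (1 - r) * (T * exp (- 1)) + (1 - r)"
      by (simp add: c_def algebra_simps)
    finally have "(1 - r) * q \<le> (1 - r) * (T * exp (- 1)) + (1 - r)" .
    moreover have "(1 - r) * (T * exp (- 1)) + T * exp (- 1) \<le> T * exp (- r)"
    proof -
      have "(1 + (1 - r)) * exp (- 1) \<le> exp (1 - r) * exp (- 1)"
        by (intro mult_right_mono exp_ge_add_one_self) auto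
      also have "\<dots> = exp (- r)" by (simp add: exp_add[symmetric])
      finally show ?thesis using mult_left_mono[of _ _ "real T"] by (fastforce simp: algebra_simps)
    qed
    ultimately show ?thesis using True assms by (simp add: g_def c_def)
  next
    case False
    then have x: "0 < real q - 1" "T * exp (- 1) \<le> real q - 1" using c by (auto simp: c_def)
    have "g q = (real q - 1) * ln (T / (real q - 1)) + ln (T / (real q - 1))"
      using False by (simp add: g_def algebra_simps)
    also have "\<dots> \<le> T * exp (- r) - (1 - r) * (real q - 1) + 1"
      using x T by (intro add_mono mult_ln_div_le ln1) auto
    also have "\<dots> \<le> 2 + T * exp (- r) - (1 - r) * q"
      using assms by (simp add: algebra_simps)
    finally show ?thesis .
  qed
  finally show ?thesis using \<open>0 \<le> Y\<close> by (simp add: mult_right_mono)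
qed

text \<open>Here \<open>y q\<close> is the probability that Phase 1 ends after \<open>q\<close> items, \<open>a q\<close> that it ends with
  accepting the best item so far, and \<open>G q\<close> bounds what Phase 2 is then worth.\<close>

lemma two_phase_potential_bound:
  fixes a y G W :: "nat \<Rightarrow> real"
  assumes a: "\<And>q. 1 \<le> q \<Longrightarrow> q \<le> n \<Longrightarrow> 0 \<le> a q" "\<And>q. 1 \<le> q \<Longrightarrow> q \<le> n \<Longrightarrow> a q \<le> y q"
      "\<And>q. 1 \<le> q \<Longrightarrow> q \<le> n \<Longrightarrow> q * a q \<le> 1 - (\<Sum>u\<in>{0<..<q}. y u)"
    and y: "(\<Sum>u\<in>{0<..n}. y u) = 1"
    and W: "\<And>q. 1 \<le> q \<Longrightarrow> q \<le> n \<Longrightarrow> W q \<le> W (q - 1)"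
      "\<And>q. 1 \<le> q \<Longrightarrow> q \<le> n \<Longrightarrow> q + G q + (real q - 1) * W q \<le> q * W (q - 1)"
      "\<And>q. 1 \<le> q \<Longrightarrow> q \<le> n \<Longrightarrow> G q \<le> W q"
  shows "(\<Sum>q\<in>{0<..n}. q * a q + G q * y q) \<le> W 0"
proof -
  have rest: "0 \<le> 1 - (\<Sum>u\<in>{0<..p}. y u)" if "p \<le> n" for p
  proof -
    have "0 \<le> y u" if "1 \<le> u" "u \<le> n" for u
      using a(1,2)[OF that] by linarith
    then have "(\<Sum>u\<in>{0<..p}. y u) \<le> (\<Sum>u\<in>{0<..n}. y u)"
      using that by (intro sum_mono2) auto
    then show ?thesis by (simp add: y)
  qed
  have "(\<Sum>q\<in>{p<..n}. q * a q + G q * y q) \<le> W p * (1 - (\<Sum>u\<in>{0<..p}. y u))" if "p \<le> n" for p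
    using that
  proof (induction p rule: inc_induct)
    \<comment> \<open>Phase 1 ends at time \<open>n\<close> at the latest, so no mass is
      left.\<close>
    case base
    then show ?case by (simp add: y)
  next
    case (step p)
    let ?w = "Suc p" and ?R = "1 - (\<Sum>u\<in>{0<..p}. y u)"
    have eqs: "{p<..n} = insert ?w {?w<..n}" "{0<..?w} = insert ?w {0<..p}" "{0<..<?w} = {0<..p}"
      using step by auto
    have R: "0 \<le> ?R" "0 \<le> a ?w" "a ?w \<le> y ?w" "?w * a ?w \<le> ?R"
      using rest[of p] step a[of ?w] eqs(3) by auto
    have pot: "W ?w \<le> W p" "?w + G ?w + (real ?w - 1) * W ?w \<le> ?w * W p" "G ?w \<le> W ?w"
      using W[of ?w] step by auto
    have "(\<Sum>q\<in>{p<..n}. q * a q + G q * y q)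
        = ?w * a ?w + G ?w * y ?w + (\<Sum>q\<in>{?w<..n}. q * a q + G q * y q)"
      unfolding eqs(1) by (subst sum.insert) auto
    also have "\<dots> \<le> ?w * a ?w + G ?w * y ?w + W ?w * (?R - y ?w)"
    proof -
      have "(\<Sum>q\<in>{?w<..n}. q * a q + G q * y q) \<le> W ?w * (1 - (\<Sum>u\<in>{0<..?w}. y u))"
        using step by simp
      then show ?thesis unfolding eqs(2) by (simp add: algebra_simps)
    qed
    \<comment> \<open>Because \<open>G ?w \<le> W ?w\<close>, ending Phase 1 without a best item is
      dominated by continuing, so the mass \<open>y ?w\<close> may be lowered to
      \<open>a ?w\<close>.\<close>
    also have "\<dots> \<le> ?w * a ?w + (G ?w - W ?w) * a ?w + W ?w * ?R"
      using mult_left_mono[OF R(3), of "W ?w - G ?w"] pot(3) by (simp add: algebra_simps)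
    also have "\<dots> \<le> W p * ?R"
    proof -
      have "?w * (?w * a ?w + (G ?w - W ?w) * a ?w + W ?w * ?R)
          = (?w * a ?w) * (?w + G ?w - W ?w) + ?w * (W ?w * ?R)"
        by (simp add: algebra_simps)
      also have "\<dots> \<le> (?w * a ?w) * (?w * (W p - W ?w)) + ?w * (W ?w * ?R)"
        using pot(2) R(2) by (intro add_right_mono mult_left_mono) (auto simp: algebra_simps)
      also have "\<dots> \<le> ?R * (?w * (W p - W ?w)) + ?w * (W ?w * ?R)"
        using R(4) pot(1) by (intro add_right_mono mult_right_mono) auto
      also have "\<dots> = ?w * (W p * ?R)"
        by (simp add: algebra_simps)
      finally show ?thesis
        by (simp del: of_nat_Suc)
    qed
    finally show ?case .
  qed
  from this[of 0] show ?thesis by simp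
qed

text \<open>A function of the form \<open>p t = a + b * t + c * t\<^sup>2 - k * t * ln (2 * t)\<close> satisfies
  \<open>p t - t * p' t = a + k * t - c * t\<^sup>2\<close>. To be superharmonic this must be at least \<open>t\<close> plus the
  value of Phase 2; \<open>a\<close>, \<open>c\<close>, \<open>k\<close> are a close numerical fit from above, and \<open>b\<close> makes
  \<open>p (1 / 2)\<close> slightly larger than the value \<open>ln 2 / 2\<close> of Phase 2 alone. The maximum of
  \<open>p\<close>, just below 0.502, is near \<open>t = 0.232\<close>.\<close>

definition potential :: "real \<Rightarrow> real" where
  "potential t = 0.1521 + 0.1693 * t + 0.44 * t\<^sup>2 - 1.61 * (t * ln (2 * t))"

text \<open>The discrete form of \<open>p t - t * p' t\<close>: the linear term of
  \<open>potential\<close> cancels exactly, and \<open>ln z \<le> z - 1\<close> handles the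
  difference of logarithms.\<close>

lemma potential_step:
  fixes x M :: real
  assumes "1 < x" "0 < M"
  shows "0.1521 + 1.61 * ((x - 1) / M) - 0.44 * (x / M)\<^sup>2
    \<le> x * potential ((x - 1) / M) - (x - 1) * potential (x / M)"
proof -
  have "ln (2 * ((x - 1) / M)) - ln (2 * (x / M)) = ln ((x - 1) / x)"
    using assms by (subst ln_divide_pos[symmetric]) (auto simp: divide_simps)
  also have "\<dots> \<le> (x - 1) / x - 1"
    using assms by (intro ln_le_minus_one) auto
  finally have "1 / x \<le> ln (2 * (x / M)) - ln (2 * ((x - 1) / M))"
    using assms by (simp add: field_simps)
  then have "1.61 * (x * (x - 1) / M) * (1 / x)
      \<le> 1.61 * (x * (x - 1) / M) * (ln (2 * (x / M)) - ln (2 * ((x - 1) / M)))"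
    using assms by (intro mult_left_mono) auto
  moreover have "1.61 * (x * (x - 1) / M) * (1 / x) = 1.61 * ((x - 1) / M)"
    using assms by simp
  moreover have "x * potential ((x - 1) / M) - (x - 1) * potential (x / M)
      = 0.1521 + 1.61 * (x * (x - 1) / M) * (ln (2 * (x / M)) - ln (2 * ((x - 1) / M)))
        - 0.44 * (x * (x - 1) / M\<^sup>2)"
    using assms unfolding potential_def
    by (simp add: power2_eq_square divide_simps) (simp add: algebra_simps)
  moreover have "x * (x - 1) / M\<^sup>2 \<le> (x / M)\<^sup>2"
    using assms by (simp add: power_divide power2_eq_square divide_right_mono)
  ultimately show ?thesis
    by (metis (no_types, opaque_lifting) diff_mono add_left_mono mult_left_mono zero_le_numeral
        divide_nonneg_nonneg zero_le_power)
qed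

lemma square_le_chord: "t\<^sup>2 \<le> (l + u) * t - l * u" if "l \<le> t" "t \<le> u" for t l u :: real
  using mult_nonneg_nonneg[of "t - l" "u - t"] that by (simp add: power2_eq_square algebra_simps)

text \<open>The first bound is the tangent of the concave function \<open>- (t * ln (2 * t))\<close>
  at \<open>t = 0.2323\<close>, rounded up; the second is sharp at \<open>t = 1 / 2\<close>.\<close>

lemma minus_ln_bounds:
  fixes t :: real
  assumes "0.2323 \<le> t"
  shows "- (t * ln (2 * t)) \<le> - 0.2334 * t + 0.2323" "2 * t\<^sup>2 - t \<ge> t * ln (2 * t)"
proof -
  have "- 0.7666 = ln (exp (- 0.7666 :: real))" by simp
  also have "\<dots> \<le> ln 0.4646"
    using exp_minus_bounds(4) by (intro ln_mono) auto
  finally have "- 0.7666 \<le> ln (0.4646 :: real)" .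
  moreover have "ln (0.4646 / (2 * t)) \<le> 0.4646 / (2 * t) - 1"
    using assms by (intro ln_le_minus_one) auto
  moreover have "ln (0.4646 / (2 * t)) = ln 0.4646 - ln (2 * t)"
    using assms by (intro ln_divide_pos) auto
  ultimately have "t * (- ln (2 * t)) \<le> t * (0.4646 / (2 * t) - 1 + 0.7666)"
    using assms by (intro mult_left_mono) auto
  also have "\<dots> = - 0.2334 * t + 0.2323"
    using assms by (simp add: field_simps)
  finally show "- (t * ln (2 * t)) \<le> - 0.2334 * t + 0.2323" by simp
  have "t * ln (2 * t) \<le> t * (2 * t - 1)"
    using assms by (intro mult_left_mono ln_le_minus_one) auto
  then show "2 * t\<^sup>2 - t \<ge> t * ln (2 * t)" by (simp add: power2_eq_square algebra_simps)
qed

text \<open>This interval contains the first position after the switch in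
  \<open>value_bound\<close>; there must be no upward jump.\<close>

lemma potential_le: "potential t \<le> 0.50195" if "0.2323 \<le> t" "t \<le> 0.2333"
proof -
  \<comment> \<open>With \<open>t\<^sup>2\<close> and \<open>t * ln (2 * t)\<close> replaced by
    variables, linear arithmetic decides the claim.\<close>
  have "0.1521 + 0.1693 * t + 0.44 * s - 1.61 * l \<le> 0.50195"
    if "- l \<le> - 0.2334 * t + 0.2323" "s \<le> (0.2323 + 0.2333) * t - 0.2323 * 0.2333" for s l
    using that \<open>0.2323 \<le> t\<close> \<open>t \<le> 0.2333\<close> by simp
  then show ?thesis
    unfolding potential_def using minus_ln_bounds(1)[OF that(1)] square_le_chord[OF that] by blast
qed

text \<open>The constant lies just below \<open>potential (1 / 2) = 0.34675\<close> and above all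
  values of Phase 2, so that ending Phase 1 never beats the potential.\<close>

lemma potential_ge: "0.34674 \<le> potential t" if "0.2323 \<le> t" "t \<le> 0.5"
proof -
  have "0.34674 \<le> 0.1521 + 0.1693 * t + 0.44 * s - 1.61 * l"
    if "2 * s - t \<ge> l" "s \<le> (0.2323 + 0.5) * t - 0.2323 * 0.5" for s l
    using that \<open>0.2323 \<le> t\<close> \<open>t \<le> 0.5\<close> by simp
  then show ?thesis
    unfolding potential_def using minus_ln_bounds(2)[OF that(1)] square_le_chord[OF that] by blast
qed

text \<open>Monotonicity in disguise: the right-hand side is \<open>p t - t * p' t\<close>, so the
  inequality forces \<open>p' t < 0\<close>.\<close>

lemma potential_le_drift: "potential t + 0.0001 \<le> 0.1521 + 1.61 * t - 0.44 * t\<^sup>2" if "0.2323 \<le> t" "t \<le> 0.5"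
proof -
  have "0.1521 + 0.1693 * t + 0.44 * s - 1.61 * l + 0.0001 \<le> 0.1521 + 1.61 * t - 0.44 * s"
    if "- l \<le> - 0.2334 * t + 0.2323" "s \<le> (0.2323 + 0.5) * t - 0.2323 * 0.5" for s l
    using that \<open>0.2323 \<le> t\<close> \<open>t \<le> 0.5\<close> by simp
  then show ?thesis
    unfolding potential_def using minus_ln_bounds(1)[OF that(1)] square_le_chord[OF that] by blast
qed

text \<open>The value \<open>t * ln (1 + 1 / (2 * t))\<close> of Phase 2 enters through its tangents, given by
  \<open>exp (- r)\<close> for \<open>r = 1, 0.85, 0.7\<close>. The case distinction is at their intersections.\<close>

lemma tangents_le_drift:
  fixes t g e :: real
  assumes "0.2323 \<le> t" "t \<le> 0.5" "g \<le> e + (t + 0.5) * 0.36788 - (1 - 1) * t"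
    "g \<le> e + (t + 0.5) * 0.42742 - (1 - 0.85) * t"
    "g \<le> e + (t + 0.5) * 0.49659 - (1 - 0.7) * t"
  shows "t + g + 0.0001 \<le> e + 0.1521 + 1.61 * t - 0.44 * t\<^sup>2"
proof -
  consider "t \<le> 0.329" | "0.329 \<le> t" "t \<le> 0.428" | "0.428 \<le> t" by linarith
  then show ?thesis
  proof cases
    case 1
    with square_le_chord[OF assms(1) 1] assms show ?thesis by (simp add: field_simps)
  next
    case 2
    with square_le_chord[OF 2] assms show ?thesis by (simp add: field_simps)
  next
    case 3
    with square_le_chord[OF 3 assms(2)] assms show ?thesis by (simp add: field_simps)
  qed
qed

text \<open>Flat up to the time at which accepting a best item, worth about
  \<open>t + (t + 1 / 2) / e\<close>, becomes competitive with 0.50195.\<close>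

definition value_bound :: "nat \<Rightarrow> nat \<Rightarrow> real" where
  "value_bound n q = (if real q < 0.2323 * (2 * n) then 0.50195 else potential (q / (2 * n)))"

text \<open>The three requirements on \<open>W\<close> in the two-phase bound, with \<open>g\<close>
  in the role of \<open>G q\<close>. Division by \<open>M = 2 * n\<close> makes them inequalities in
  \<open>t\<close> with mesh \<open>d\<close>; the size of \<open>n\<close> makes \<open>d\<close>
  fit into the numerical slack.\<close>

lemma value_bound_conditions:
  fixes g :: real
  assumes "100000 \<le> n" "1 \<le> q" "q \<le> n"
    and g: "\<And>r. 0 \<le> r \<Longrightarrow> r \<le> 1 \<Longrightarrow> g \<le> 2 + (q + n) * exp (- r) - (1 - r) * q"
  shows "value_bound n q \<le> value_bound n (q - 1)"
    and "q + g + (real q - 1) * (2 * real n * value_bound n q) \<le> q * (2 * real n * value_bound n (q - 1))"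
    and "g \<le> 2 * real n * value_bound n q"
proof -
  define M t d where "M = 2 * real n" and "t = q / M" and "d = 1 / M"
  have M: "200000 \<le> M" using assms by (simp add: M_def)
  have d: "0 < d" "d \<le> 0.000005" using M by (auto simp: d_def divide_simps)
  have t: "0 < t" "t \<le> 0.5" "real q = t * M" "(real q - 1) / M = t - d" "real (q - 1) / M = t - d"
    using assms M by (auto simp: t_def d_def M_def field_simps)
  have n: "real n = 0.5 * M" by (simp add: M_def)
  have tangent: "g / M \<le> 2 * d + (t + 0.5) * c - (1 - r) * t"
    if "0 \<le> r" "r \<le> 1" "exp (- r) \<le> c" for r c
  proof -
    have "g \<le> 2 + (q + n) * c - (1 - r) * q"
      using g[OF that(1,2)] mult_left_mono[OF that(3), of "q + n"] by simp
    also have "\<dots> = M * (2 * d + (t + 0.5) * c - (1 - r) * t)"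
      using M by (simp add: n t(3) d_def algebra_simps)
    finally show ?thesis using M by (simp add: field_simps)
  qed
  note g1 = tangent[OF _ _ exp_minus_bounds(1)] and g2 = tangent[OF _ _ exp_minus_bounds(2)]
    and g3 = tangent[OF _ _ exp_minus_bounds(3)]
  have V: "value_bound n q = (if t < 0.2323 then 0.50195 else potential t)"
    "value_bound n (q - 1) = (if t - d < 0.2323 then 0.50195 else potential (t - d))"
  proof -
    have iff: "x < 0.2323 * M \<longleftrightarrow> x / M < 0.2323" for x
      using M by (simp add: pos_divide_less_eq)
    show "value_bound n q = (if t < 0.2323 then 0.50195 else potential t)"
      unfolding value_bound_def M_def[symmetric] iff t_def ..
    show "value_bound n (q - 1) = (if t - d < 0.2323 then 0.50195 else potential (t - d))"
      unfolding value_bound_def M_def[symmetric] iff t(5) ..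
  qed
  have gV: "g / M \<le> value_bound n q"
  proof -
    \<comment> \<open>The tangent for \<open>r = 0.7\<close> increases in \<open>t\<close>, so its
      value at \<open>t = 0.5\<close> decides.\<close>
    have "h \<le> 0.34674" if "h \<le> 2 * d + (t + 0.5) * 0.49659 - (1 - 0.7) * t" for h
      using that t(2) d by (simp add: field_simps)
    from this[of "g / M"] have "g / M \<le> 0.34674"
      using g3 by simp
    also have "\<dots> \<le> value_bound n q"
      using V(1) potential_ge[of t] t(2) by (simp add: not_less)
    finally show ?thesis .
  qed
  then have "g \<le> value_bound n q * M"
    using M by (simp add: pos_divide_le_eq)
  then show "g \<le> 2 * real n * value_bound n q"
    by (simp add: M_def algebra_simps)
  have early: "t + g / M \<le> 0.50195" if "t - d < 0.2323"
  proof -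
    have "t + h \<le> 0.50195" if "h \<le> 2 * d + (t + 0.5) * 0.36788 - (1 - 1) * t" for h
      using that \<open>t - d < 0.2323\<close> d by (simp add: field_simps)
    from this[of "g / M"] show ?thesis
      using g1 by simp
  qed
  have drift: "value_bound n q \<le> value_bound n (q - 1)
      \<and> t + g / M + (real q - 1) * value_bound n q \<le> q * value_bound n (q - 1)"
  proof (cases "t - d < 0.2323")
    case True
    then have K: "value_bound n (q - 1) = 0.50195"
      using V(2) by simp
    have le: "value_bound n q \<le> value_bound n (q - 1)"
      unfolding K using True V(1) potential_le[of t] d by auto
    have "(real q - 1) * value_bound n q \<le> (real q - 1) * value_bound n (q - 1)"
      using le assms by (intro mult_left_mono) auto
    moreover have "t + g / M \<le> value_bound n (q - 1)"
      unfolding K using early[OF True] .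
    ultimately have "t + g / M + (real q - 1) * value_bound n q \<le> q * value_bound n (q - 1)"
      unfolding left_diff_distrib by linarith
    then show ?thesis using le by simp
  next
    case False
    have "1 < real q"
    proof -
      have "1 < 0.2323 * M" using M by simp
      also have "\<dots> \<le> real q" using False d M unfolding t(3) by (intro mult_right_mono) auto
      finally show ?thesis .
    qed
    then have step: "0.1521 + 1.61 * (t - d) - 0.44 * t\<^sup>2 \<le> q * potential (t - d) - (real q - 1) * potential t"
      using potential_step[of "real q" M] M t(4) by (simp add: t_def)
    have Vs: "value_bound n q = potential t" "value_bound n (q - 1) = potential (t - d)"
      using False V d by auto
    have "t + g / M + 0.0001 \<le> 2 * d + 0.1521 + 1.61 * t - 0.44 * t\<^sup>2"
      using False d t(2) by (intro tangents_le_drift[OF _ _ g1 g2 g3]) auto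
    \<comment> \<open>The slack 0.0001 pays for \<open>2 * d\<close> from the tangents and
      \<open>1.61 * d\<close> from the shifted argument in \<open>potential_step\<close>.\<close>
    moreover have "t + h + w \<le> z" if "t + h + 0.0001 \<le> 2 * d + 0.1521 + 1.61 * t - 0.44 * s"
      "0.1521 + 1.61 * (t - d) - 0.44 * s \<le> z - w" for h s w z
      using that d by (simp add: field_simps)
    ultimately have 1: "t + g / M + (real q - 1) * potential t \<le> q * potential (t - d)"
      using step by blast
    have "potential t + 0.0001 \<le> 0.1521 + 1.61 * t - 0.44 * t\<^sup>2"
      using False d t(2) by (intro potential_le_drift) auto
    moreover have "u \<le> z" if "u + 0.0001 \<le> 0.1521 + 1.61 * t - 0.44 * s"
      "0.1521 + 1.61 * (t - d) - 0.44 * s \<le> z" for u s z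
      using that d by (simp add: field_simps)
    ultimately have "potential t \<le> q * potential (t - d) - (real q - 1) * potential t"
      using step by blast
    then have "q * potential t \<le> q * potential (t - d)"
      by (simp add: algebra_simps)
    then show ?thesis using 1 Vs \<open>1 < real q\<close> by simp
  qed
  then show "value_bound n q \<le> value_bound n (q - 1)" by simp
  from drift have "M * (t + g / M + (real q - 1) * value_bound n q) \<le> M * (q * value_bound n (q - 1))"
    using M by (intro mult_left_mono) auto
  moreover have "M * (t + g / M + u) = q + g + M * u" for u
    using M by (simp add: t_def distrib_left)
  ultimately have "q + g + M * ((real q - 1) * value_bound n q) \<le> M * (q * value_bound n (q - 1))"
    by simp
  then show "q + g + (real q - 1) * (2 * real n * value_bound n q) \<le> q * (2 * real n * value_bound n (q - 1))"
    by (simp add: M_def algebra_simps)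
qed

section \<open>The hard instance\<close>

text \<open>With zeros instead of the small values, a tie-breaking rule could rank every new zero
  last and so reveal the best item.\<close>

definition hard_instance :: "nat \<Rightarrow> real list" where
  "hard_instance n = map (\<lambda>i. if i = 0 then 1 else real (2 * n - i) / (2 * real n)\<^sup>2) [0..<2 * n]"

lemma length_hard_instance [simp]: "length (hard_instance n) = 2 * n"
  by (simp add: hard_instance_def)

lemma hard_instance_0: "0 < n \<Longrightarrow> hard_instance n ! 0 = 1"
  by (simp add: hard_instance_def)

lemma hard_instance_nonneg: "i < 2 * n \<Longrightarrow> 0 \<le> hard_instance n ! i"
  by (simp add: hard_instance_def)

lemma hard_instance_small:
  assumes "0 < i" "i < 2 * n"
  shows "hard_instance n ! i \<le> 1 / (2 * n)"
proof -
  have "real (2 * n - i) / (2 * real n)\<^sup>2 \<le> 2 * real n / (2 * real n)\<^sup>2"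
    by (intro divide_right_mono) auto
  also have "\<dots> = 1 / (2 * n)" by (simp add: power2_eq_square)
  finally show ?thesis using assms by (simp add: hard_instance_def)
qed

lemma hard_instance_strict_decreasing:
  assumes "i < j" "j < 2 * n"
  shows "hard_instance n ! j < hard_instance n ! i"
proof (cases "i = 0")
  case True
  have "real (2 * n - j) / (2 * real n)\<^sup>2 < 2 * real n / (2 * real n)\<^sup>2"
    using assms by (intro divide_strict_right_mono) auto
  also have "\<dots> \<le> 1" using assms by (simp add: power2_eq_square)
  finally show ?thesis using assms True by (simp add: hard_instance_def)
next
  case False
  then show ?thesis
    using assms by (simp add: hard_instance_def divide_strict_right_mono)
qed

lemma hard_instance_less_iff:
  "i < 2 * n \<Longrightarrow> j < 2 * n \<Longrightarrow> hard_instance n ! j < hard_instance n ! i \<longleftrightarrow> i < j"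
  by (metis hard_instance_strict_decreasing less_asym linorder_neqE_nat less_irrefl)

lemma hard_instance_in_instances: "hard_instance n \<in> instances n"
  unfolding instances_def
  by (auto simp: sorted_wrt_iff_nth_less in_set_conv_nth hard_instance_nonneg
      intro: less_imp_le hard_instance_strict_decreasing)

text \<open>The values are pairwise distinct, so the two bounds on a valid rule coincide.\<close>

lemma hard_instance_rank:
  assumes "valid_ranking_rule \<rho>" "distinct (as @ bs)" "set (as @ bs) \<subseteq> {..<2 * n}" "as @ bs \<noteq> []"
  shows "\<rho> n (hard_instance n) as bs
       = card {y \<in> set (butlast (as @ bs)). y < last (as @ bs)} + 1"
proof -
  let ?v = "hard_instance n" and ?x = "last (as @ bs)" and ?E = "set (butlast (as @ bs))"
  have "as @ bs = butlast (as @ bs) @ [?x]" using assms(4) by simp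
  then have x: "?x < 2 * n" "?x \<notin> ?E"
    using assms(2-4) last_in_set[OF assms(4)]
    by (blast, metis distinct_append disjoint_iff list.set_intros(1))
  have E: "y < 2 * n" if "y \<in> ?E" for y
    using assms(3) in_set_butlastD[OF that] by blast
  have "{y \<in> ?E. ?v ! y > ?v ! ?x} = {y \<in> ?E. y < ?x}"
    using hard_instance_less_iff x(1) E by blast
  moreover have "{y \<in> ?E. ?v ! y \<ge> ?v ! ?x} = {y \<in> ?E. y < ?x}"
  proof -
    have "?v ! y \<ge> ?v ! ?x \<longleftrightarrow> y < ?x" if "y \<in> ?E" for y
    proof -
      have "y \<noteq> ?x" using that x(2) by blast
      then show ?thesis
        using hard_instance_less_iff[OF x(1) E[OF that]] by (auto simp: not_less[symmetric])
    qed
    then show ?thesis by blast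
  qed
  moreover have "card {y \<in> ?E. ?v ! y > ?v ! ?x} + 1 \<le> \<rho> n ?v as bs
      \<and> \<rho> n ?v as bs \<le> card {y \<in> ?E. ?v ! y \<ge> ?v ! ?x} + 1"
    using assms(1) hard_instance_in_instances[of n] assms(2-4)
    unfolding valid_ranking_rule_def Let_def by blast
  ultimately show ?thesis by simp
qed

lemma hard_instance_rank_same_order:
  assumes "valid_ranking_rule \<rho>" "same_order n S \<sigma> \<tau>" "S \<subseteq> {..<2 * n}"
    and "distinct (xs @ ys)" "set (xs @ ys) \<subseteq> S" "xs @ ys \<noteq> []"
  shows "\<rho> n (hard_instance n) (map \<sigma> xs) (map \<sigma> ys) = \<rho> n (hard_instance n) (map \<tau> xs) (map \<tau> ys)"
proof -
  let ?zs = "xs @ ys"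
  have rank: "\<rho> n (hard_instance n) (map \<sigma> xs) (map \<sigma> ys)
      = card {i \<in> set (butlast ?zs). \<sigma> i < \<sigma> (last ?zs)} + 1" if "\<sigma> \<in> arrival_orders n" for \<sigma>
  proof -
    have inj: "inj \<sigma>" using inj_arrival_orders[OF that] .
    have "distinct (map \<sigma> ?zs)"
      using assms(4) inj by (metis distinct_map inj_on_subset subset_UNIV)
    moreover have "set (map \<sigma> ?zs) \<subseteq> {..<2 * n}"
    proof -
      have "\<sigma> ` {..<2 * n} = {..<2 * n}"
        using that by (simp add: arrival_orders_def permutes_image)
      then show ?thesis using assms(3,5) by (metis image_mono list.set_map order_trans)
    qed
    ultimately have "\<rho> n (hard_instance n) (map \<sigma> xs) (map \<sigma> ys)
      = card {y \<in> set (butlast (map \<sigma> ?zs)). y < last (map \<sigma> ?zs)} + 1"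
      using hard_instance_rank[OF assms(1), of "map \<sigma> xs" "map \<sigma> ys" n] assms(6)
      by (simp only: map_append) simp
    also have "last (map \<sigma> ?zs) = \<sigma> (last ?zs)"
      using assms(6) by (rule last_map)
    also have "{y \<in> set (butlast (map \<sigma> ?zs)). y < \<sigma> (last ?zs)}
        = \<sigma> ` {i \<in> set (butlast ?zs). \<sigma> i < \<sigma> (last ?zs)}"
      unfolding map_butlast[symmetric] set_map by blast
    also have "card \<dots> = card {i \<in> set (butlast ?zs). \<sigma> i < \<sigma> (last ?zs)}"
      using inj by (intro card_image) (auto intro: inj_on_subset)
    finally show ?thesis .
  qed
  have "{i \<in> set (butlast ?zs). \<sigma> i < \<sigma> (last ?zs)} = {i \<in> set (butlast ?zs). \<tau> i < \<tau> (last ?zs)}"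
  proof -
    have "\<sigma> i < \<sigma> (last ?zs) \<longleftrightarrow> \<tau> i < \<tau> (last ?zs)" if "i \<in> set (butlast ?zs)" for i
      using assms(2) in_set_butlastD[OF that] last_in_set[OF assms(6)] assms(5)
      unfolding same_order_def by blast
    then show ?thesis by blast
  qed
  then show ?thesis
    using assms(2) by (simp add: rank same_order_def del: butlast_append last_append)
qed

lemma ranks1_same_order:
  assumes "valid_ranking_rule \<rho>" "same_order n S \<sigma> \<tau>" "S \<subseteq> {..<2 * n}"
    and "distinct xs" "set xs \<subseteq> S"
  shows "ranks1 (\<rho> n (hard_instance n)) (map \<sigma> xs) = ranks1 (\<rho> n (hard_instance n)) (map \<tau> xs)"
proof -
  have "\<rho> n (hard_instance n) (take k (map \<sigma> xs)) [] = \<rho> n (hard_instance n) (take k (map \<tau> xs)) []"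
    if "k \<in> set [1..<Suc (length xs)]" for k
  proof -
    have "distinct (take k xs @ [])" "set (take k xs @ []) \<subseteq> S" "take k xs @ [] \<noteq> []"
      using that assms(4,5) set_take_subset[of k xs] by auto
    from hard_instance_rank_same_order[OF assms(1-3) this] show ?thesis
      by (simp add: take_map)
  qed
  then show ?thesis by (auto simp: ranks1_def)
qed

lemma ranks2_same_order:
  assumes "valid_ranking_rule \<rho>" "same_order n S \<sigma> \<tau>" "S \<subseteq> {..<2 * n}"
    and "distinct (xs @ ys)" "set (xs @ ys) \<subseteq> S"
  shows "ranks2 (\<rho> n (hard_instance n)) (map \<sigma> xs) (map \<sigma> ys)
    = ranks2 (\<rho> n (hard_instance n)) (map \<tau> xs) (map \<tau> ys)"
proof -
  have "\<rho> n (hard_instance n) (map \<sigma> xs) (take k (map \<sigma> ys))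
      = \<rho> n (hard_instance n) (map \<tau> xs) (take k (map \<tau> ys))"
    if "k \<in> set [1..<Suc (length ys)]" for k
  proof -
    have "distinct (xs @ take k ys)" "set (xs @ take k ys) \<subseteq> S" "xs @ take k ys \<noteq> []"
      using that assms(4,5) set_take_subset[of k ys] by auto
    from hard_instance_rank_same_order[OF assms(1-3) this] show ?thesis
      by (simp add: take_map)
  qed
  then show ?thesis by (auto simp: ranks2_def)
qed

lemma run_phase_cases:
  obtains (accept) k where "0 < k" "k \<le> length xs" "acc (seen @ take k xs)"
    "\<And>j. 0 < j \<Longrightarrow> j < k \<Longrightarrow> \<not> acc (seen @ take j xs)"
    "run_phase acc seen xs = (seen @ take k xs, Some (xs ! (k - 1)))"
  | (reject) "\<And>j. 0 < j \<Longrightarrow> j \<le> length xs \<Longrightarrow> \<not> acc (seen @ take j xs)"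
    "run_phase acc seen xs = (seen @ xs, None)"
proof (induction xs arbitrary: seen thesis)
  case Nil
  then show ?case by simp
next
  case (Cons x xs)
  show ?case
  proof (cases "acc (seen @ [x])")
    case True
    then show ?thesis by (intro Cons.prems(1)[of 1]) auto
  next
    case False
    show ?thesis
    proof (rule Cons.IH[of "seen @ [x]"])
      fix k
      assume k: "0 < k" "k \<le> length xs" "acc ((seen @ [x]) @ take k xs)"
        "\<And>j. 0 < j \<Longrightarrow> j < k \<Longrightarrow> \<not> acc ((seen @ [x]) @ take j xs)"
        "run_phase acc (seen @ [x]) xs = ((seen @ [x]) @ take k xs, Some (xs ! (k - 1)))"
      have "\<not> acc (seen @ take j (x # xs))" if "0 < j" "j < Suc k" for j
        using that k(4)[of "j - 1"] False by (cases j; cases "j = 1") auto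
      then show ?thesis
        using k False by (intro Cons.prems(1)[of "Suc k"]) auto
    next
      assume r: "\<And>j. 0 < j \<Longrightarrow> j \<le> length xs \<Longrightarrow> \<not> acc ((seen @ [x]) @ take j xs)"
        "run_phase acc (seen @ [x]) xs = ((seen @ [x]) @ xs, None)"
      have "\<not> acc (seen @ take j (x # xs))" if "0 < j" "j \<le> length (x # xs)" for j
        using that r(1)[of "j - 1"] False by (cases j; cases "j = 1") auto
      then show ?thesis
        using r False by (intro Cons.prems(2)) auto
    qed
  qed
qed

lemma position_partition:
  assumes "q \<le> n" "0 < j" "j \<le> n"
  shows "card ({..<q} \<union> {n..<n + j}) = q + j" "{..<q} \<union> {n..<n + j} \<subseteq> {..<2 * n}"
    "{..<q} \<union> {n..<n + j} - {n + j - 1} = {..<q} \<union> {n..<n + j - 1}"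
proof -
  show "card ({..<q} \<union> {n..<n + j}) = q + j"
    using assms by (subst card_Un_disjoint) auto
qed (use assms in auto)

section \<open>Winning probability of a strategy\<close>

locale hard_run =
  fixes \<rho> :: ranking_rule and n :: nat and s :: strategy
  assumes valid: "valid_ranking_rule \<rho>" and pos: "0 < n"
begin

text \<open>Counters \<open>q\<close> and \<open>j\<close> are numbers of items revealed in Phases 1 and 2, so the newest
  positions are \<open>q - 1\<close> and \<open>n + j - 1\<close>; \<open>end1 n\<close> includes the case that nothing is accepted.\<close>

definition ranks_at1 :: "(nat \<Rightarrow> nat) \<Rightarrow> nat \<Rightarrow> nat list" where
  "ranks_at1 \<sigma> q = ranks1 (\<rho> n (hard_instance n)) (map \<sigma> [0..<q])"

definition accept1 :: "nat \<Rightarrow> (nat \<Rightarrow> nat) \<Rightarrow> bool" where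
  "accept1 q \<sigma> = fst s (ranks_at1 \<sigma> q)"

definition accept2 :: "nat \<Rightarrow> nat \<Rightarrow> (nat \<Rightarrow> nat) \<Rightarrow> bool" where
  "accept2 q j \<sigma> = snd s (ranks_at1 \<sigma> q)
     (ranks2 (\<rho> n (hard_instance n)) (map \<sigma> [0..<q]) (map \<sigma> [n..<n + j]))"

definition idle1 :: "nat \<Rightarrow> (nat \<Rightarrow> nat) \<Rightarrow> bool" where
  "idle1 q \<sigma> \<longleftrightarrow> (\<forall>u\<in>{0<..<q}. \<not> accept1 u \<sigma>)"

definition stop1 :: "nat \<Rightarrow> (nat \<Rightarrow> nat) \<Rightarrow> bool" where
  "stop1 q \<sigma> \<longleftrightarrow> idle1 q \<sigma> \<and> accept1 q \<sigma>"

definition end1 :: "nat \<Rightarrow> (nat \<Rightarrow> nat) \<Rightarrow> bool" where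
  "end1 q \<sigma> \<longleftrightarrow> idle1 q \<sigma> \<and> (accept1 q \<sigma> \<or> q = n)"

definition idle2 :: "nat \<Rightarrow> nat \<Rightarrow> (nat \<Rightarrow> nat) \<Rightarrow> bool" where
  "idle2 q j \<sigma> \<longleftrightarrow> end1 q \<sigma> \<and> (\<forall>i\<in>{0<..<j}. \<not> accept2 q i \<sigma>)"

definition stop2 :: "nat \<Rightarrow> nat \<Rightarrow> (nat \<Rightarrow> nat) \<Rightarrow> bool" where
  "stop2 q j \<sigma> \<longleftrightarrow> idle2 q j \<sigma> \<and> accept2 q j \<sigma>"

lemma order_determined_accept1:
  assumes "q \<le> 2 * n" shows "order_determined n {..<q} (accept1 q)"
  unfolding order_determined_def accept1_def ranks_at1_def
  using ranks1_same_order[OF valid, of n "{..<q}" _ _ "[0..<q]"] assms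
  by (auto simp: atLeast0LessThan)

lemma order_determined_accept2:
  assumes "q \<le> n" "j \<le> n"
  shows "order_determined n ({..<q} \<union> {n..<n + j}) (accept2 q j)"
proof -
  have "accept2 q j \<sigma> = accept2 q j \<tau>" if "same_order n ({..<q} \<union> {n..<n + j}) \<sigma> \<tau>" for \<sigma> \<tau>
  proof -
    have S: "{..<q} \<union> {n..<n + j} \<subseteq> {..<2 * n}" "{..<q} \<inter> {n..<n + j} = {}"
      using assms by auto
    show ?thesis
      using ranks1_same_order[OF valid that S(1), of "[0..<q]"]
        ranks2_same_order[OF valid that S(1), of "[0..<q]" "[n..<n + j]"] S(2)
      unfolding accept2_def ranks_at1_def by (auto simp: atLeast0LessThan)
  qed
  then show ?thesis by (simp add: order_determined_def)
qed

text \<open>The bound \<open>q - 1\<close> matters: the newest position is excluded, which is what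
  makes its rank independent of this event.\<close>

lemma order_determined_idle1:
  assumes "q \<le> n" shows "order_determined n {..<q - 1} (idle1 q)"
  unfolding idle1_def using assms
  by (intro order_determined_ball order_determined_not order_determined_mono[OF order_determined_accept1])
    auto

lemma order_determined_stop1:
  assumes "q \<le> n" shows "order_determined n {..<q} (stop1 q)"
  unfolding stop1_def using assms
  by (intro order_determined_conj order_determined_mono[OF order_determined_idle1]
      order_determined_accept1) auto

lemma order_determined_end1:
  assumes "q \<le> n" shows "order_determined n {..<q} (end1 q)"
  unfolding end1_def using assms
  by (intro order_determined_conj order_determined_disj order_determined_const
      order_determined_mono[OF order_determined_idle1] order_determined_accept1) auto

lemma order_determined_idle2:
  assumes "q \<le> n" "j \<le> n"
  shows "order_determined n ({..<q} \<union> {n..<n + j - 1}) (idle2 q j)"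
  unfolding idle2_def using assms
  by (intro order_determined_conj order_determined_ball order_determined_not
      order_determined_mono[OF order_determined_end1] order_determined_mono[OF order_determined_accept2])
    auto

lemma order_determined_stop2:
  assumes "q \<le> n" "j \<le> n"
  shows "order_determined n ({..<q} \<union> {n..<n + j}) (stop2 q j)"
  unfolding stop2_def using assms
  by (intro order_determined_conj order_determined_mono[OF order_determined_idle2]
      order_determined_accept2) auto

lemma prob_idle1:
  assumes "0 < q" "q \<le> n"
  shows "prob_order n (idle1 q) = 1 - (\<Sum>u\<in>{0<..<q}. prob_order n (end1 u))"
  using assms
proof (induction q rule: nat_induct_non_zero)
  case 1
  have "idle1 1 = (\<lambda>_. True)" by (auto simp: idle1_def fun_eq_iff)
  moreover have "{0<..<1::nat} = {}" by auto
  ultimately show ?case by (simp only: prob_order_True sum.empty diff_zero)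
next
  case (Suc q)
  have eq: "{0<..<Suc q} = insert q {0<..<q}" using Suc by auto
  \<comment> \<open>Here \<open>q < n\<close>, so \<open>end1 q\<close> can only mean
    acceptance.\<close>
  have "prob_order n (idle1 q) = prob_order n (idle1 (Suc q)) + prob_order n (end1 q)"
    by (rule prob_order_split) (use Suc.prems in \<open>auto simp: idle1_def end1_def eq\<close>)
  then show ?case using Suc by (simp add: eq)
qed

lemma sum_prob_end1: "(\<Sum>q\<in>{0<..n}. prob_order n (end1 q)) = 1"
proof -
  have "{0<..n} = insert n {0<..<n}" using pos by auto
  moreover have "end1 n = idle1 n" by (auto simp: end1_def)
  ultimately show ?thesis using prob_idle1[of n] pos by simp
qed

lemma prob_idle2:
  assumes "0 < j"
  shows "prob_order n (idle2 q j) = prob_order n (end1 q) - (\<Sum>i\<in>{0<..<j}. prob_order n (stop2 q i))"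
  using assms
proof (induction j rule: nat_induct_non_zero)
  case 1
  have "idle2 q 1 = end1 q" by (auto simp: idle2_def fun_eq_iff)
  moreover have "{0<..<1::nat} = {}" by auto
  ultimately show ?case by (simp only: sum.empty diff_zero)
next
  case (Suc j)
  have eq: "{0<..<Suc j} = insert j {0<..<j}" using Suc by auto
  have "prob_order n (idle2 q j) = prob_order n (idle2 q (Suc j)) + prob_order n (stop2 q j)"
    by (rule prob_order_split) (auto simp: idle2_def stop2_def eq)
  then show ?case using Suc by (simp add: eq)
qed

text \<open>Acceptances of a best item so far, the only ones that can win; this is \<open>a\<close>
  in the two-phase bound.\<close>

definition best1 :: "nat \<Rightarrow> real" where
  "best1 q = prob_order n (\<lambda>\<sigma>. stop1 q \<sigma> \<and> (\<forall>x\<in>{..<q}. \<sigma> (q - 1) \<le> \<sigma> x))"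

definition best2 :: "nat \<Rightarrow> nat \<Rightarrow> real" where
  "best2 q j = prob_order n (\<lambda>\<sigma>. stop2 q j \<sigma> \<and> (\<forall>x\<in>{..<q} \<union> {n..<n + j}. \<sigma> (n + j - 1) \<le> \<sigma> x))"

lemma win1:
  assumes "0 < q" "q \<le> n"
  shows "2 * n * prob_order n (\<lambda>\<sigma>. stop1 q \<sigma> \<and> \<sigma> (q - 1) = 0) = q * best1 q"
  using prob_overall_best[of "{..<q}" n "q - 1" "stop1 q"] order_determined_stop1[of q] assms
  by (simp add: best1_def)

lemma win2:
  assumes "q \<le> n" "0 < j" "j \<le> n"
  shows "2 * n * prob_order n (\<lambda>\<sigma>. stop2 q j \<sigma> \<and> \<sigma> (n + j - 1) = 0) = real (q + j) * best2 q j"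
proof -
  have "n + j - 1 \<in> {..<q} \<union> {n..<n + j}" using assms by auto
  from prob_overall_best[OF position_partition(2)[OF assms] this order_determined_stop2] assms
  show ?thesis unfolding best2_def position_partition(1)[OF assms] by simp
qed

lemma best1_bounds:
  assumes "0 < q" "q \<le> n"
  shows "0 \<le> best1 q" "best1 q \<le> prob_order n (end1 q)"
    "q * best1 q \<le> 1 - (\<Sum>u\<in>{0<..<q}. prob_order n (end1 u))"
proof -
  show "0 \<le> best1 q" by (simp add: best1_def prob_order_nonneg)
  show "best1 q \<le> prob_order n (end1 q)"
    unfolding best1_def by (rule prob_order_mono) (auto simp: stop1_def end1_def)
  have "best1 q \<le> prob_order n (\<lambda>\<sigma>. idle1 q \<sigma> \<and> (\<forall>x\<in>{..<q}. \<sigma> (q - 1) \<le> \<sigma> x))"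
    unfolding best1_def by (rule prob_order_mono) (auto simp: stop1_def)
  then have "q * best1 q \<le> card {..<q} * prob_order n (\<lambda>\<sigma>. idle1 q \<sigma> \<and> (\<forall>x\<in>{..<q}. \<sigma> (q - 1) \<le> \<sigma> x))"
    by (simp add: mult_left_mono)
  also have "\<dots> = prob_order n (idle1 q)"
  proof (rule prob_best_position)
    have "{..<q} - {q - 1} = {..<q - 1}" using assms by auto
    then show "order_determined n ({..<q} - {q - 1}) (idle1 q)"
      using order_determined_idle1[OF assms(2)] by simp
  qed (use assms in auto)
  finally show "q * best1 q \<le> 1 - (\<Sum>u\<in>{0<..<q}. prob_order n (end1 u))"
    using prob_idle1[OF assms] by simp
qed

lemma best2_nonneg: "0 \<le> best2 q j"
  by (simp add: best2_def prob_order_nonneg)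

lemma best2_bound:
  assumes "q \<le> n" "0 < j" "j \<le> n"
  shows "real (q + j) * best2 q j \<le> prob_order n (end1 q) - (\<Sum>i\<in>{0<..<j}. best2 q i)"
proof -
  let ?S = "{..<q} \<union> {n..<n + j}"
  have "best2 q j \<le> prob_order n (\<lambda>\<sigma>. idle2 q j \<sigma> \<and> (\<forall>x\<in>?S. \<sigma> (n + j - 1) \<le> \<sigma> x))"
    unfolding best2_def by (rule prob_order_mono) (auto simp: stop2_def)
  then have "real (q + j) * best2 q j
      \<le> card ?S * prob_order n (\<lambda>\<sigma>. idle2 q j \<sigma> \<and> (\<forall>x\<in>?S. \<sigma> (n + j - 1) \<le> \<sigma> x))"
    unfolding position_partition(1)[OF assms] by (intro mult_left_mono) auto
  also have "\<dots> = prob_order n (idle2 q j)"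
  proof (rule prob_best_position)
    show "order_determined n (?S - {n + j - 1}) (idle2 q j)"
      unfolding position_partition(3)[OF assms] using assms by (intro order_determined_idle2)
  qed (use assms in auto)
  also have "\<dots> = prob_order n (end1 q) - (\<Sum>i\<in>{0<..<j}. prob_order n (stop2 q i))"
    using prob_idle2[OF assms(2)] .
  \<comment> \<open>Accepting an item that is not the best only removes mass; dropping it leaves an
    inequality in \<open>best2\<close> alone.\<close>
  also have "\<dots> \<le> prob_order n (end1 q) - (\<Sum>i\<in>{0<..<j}. best2 q i)"
  proof -
    have "best2 q i \<le> prob_order n (stop2 q i)" for i
      unfolding best2_def by (rule prob_order_mono) auto
    then show ?thesis by (simp add: sum_mono)
  qed
  finally show ?thesis .
qed

lemma phase2_bound:
  assumes "0 < q" "q \<le> n" "0 \<le> r" "r \<le> 1"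
  shows "(\<Sum>j\<in>{0<..n}. real (q + j) * best2 q j)
    \<le> (2 + (q + n) * exp (- r) - (1 - r) * q) * prob_order n (end1 q)"
proof -
  have shift: "(\<Sum>i\<in>{0<..<w - q}. best2 q i) = (\<Sum>u\<in>{q<..<w}. best2 q (u - q))" for w
    by (rule sum.reindex_bij_witness[of _ "\<lambda>u. u - q" "\<lambda>i. i + q"]) auto
  have "(\<Sum>j\<in>{0<..n}. real (q + j) * best2 q j) = (\<Sum>w\<in>{q<..q + n}. real w * best2 q (w - q))"
    by (rule sum.reindex_bij_witness[of _ "\<lambda>w. w - q" "\<lambda>j. j + q"]) (auto simp: add.commute)
  also have "\<dots> \<le> (2 + (q + n) * exp (- r) - (1 - r) * q) * prob_order n (end1 q)"
  proof (rule single_phase_bound)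
    fix w assume "q < w" "w \<le> q + n"
    then show "real w * best2 q (w - q) \<le> prob_order n (end1 q) - (\<Sum>u\<in>{q<..<w}. best2 q (u - q))"
      using best2_bound[of q "w - q"] assms by (simp add: shift)
  qed (use assms best2_nonneg prob_order_nonneg in auto)
  finally show ?thesis .
qed

lemma win_probability_bound:
  assumes "100000 \<le> n"
  shows "(\<Sum>q\<in>{0<..n}. prob_order n (\<lambda>\<sigma>. stop1 q \<sigma> \<and> \<sigma> (q - 1) = 0)
      + (\<Sum>j\<in>{0<..n}. prob_order n (\<lambda>\<sigma>. stop2 q j \<sigma> \<and> \<sigma> (n + j - 1) = 0))) \<le> 0.50195"
proof -
  define S y where "S q = (\<Sum>j\<in>{0<..n}. real (q + j) * best2 q j)" and "y q = prob_order n (end1 q)" for q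
  \<comment> \<open>The gain of Phase 2, in units of \<open>1 / (2 * n)\<close>, given that Phase 1
    ends at \<open>q\<close>. If \<open>y q = 0\<close>, the quotient is 0, and \<open>S q\<close>
    vanishes too by \<open>S_le\<close>.\<close>
  define G where "G q = S q / y q" for q
  have S_nonneg: "0 \<le> S q" for q
    unfolding S_def by (intro sum_nonneg mult_nonneg_nonneg best2_nonneg) auto
  have y_nonneg: "0 \<le> y q" for q by (simp add: y_def prob_order_nonneg)
  have S_le: "S q \<le> (2 + (q + n) * exp (- r) - (1 - r) * q) * y q"
    if "0 < q" "q \<le> n" "0 \<le> r" "r \<le> 1" for q r
    using phase2_bound[OF that] by (simp add: S_def y_def)
  have S_eq: "S q = G q * y q" if "0 < q" "q \<le> n" for q
    using S_le[OF that, of 0] S_nonneg[of q] by (cases "y q = 0") (auto simp: G_def)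
  have G_le: "G q \<le> 2 + (q + n) * exp (- r) - (1 - r) * q"
    if "0 < q" "q \<le> n" "0 \<le> r" "r \<le> 1" for q r
  proof (cases "y q = 0")
    case True
    have "(1 - r) * q \<le> exp (- r) * q"
      using exp_ge_add_one_self[of "- r"] by (intro mult_right_mono) auto
    also have "\<dots> \<le> (q + n) * exp (- r)" by (simp add: algebra_simps)
    finally show ?thesis by (simp add: G_def True)
  next
    case False
    then show ?thesis
      using S_le[OF that] y_nonneg[of q] by (simp add: G_def pos_divide_le_eq)
  qed
  have "(\<Sum>q\<in>{0<..n}. q * best1 q + G q * y q) \<le> 2 * real n * value_bound n 0"
  proof (rule two_phase_potential_bound[where W = "\<lambda>q. 2 * real n * value_bound n q"])
    fix q assume q: "1 \<le> q" "q \<le> n"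
    show "0 \<le> best1 q" "best1 q \<le> y q" "q * best1 q \<le> 1 - (\<Sum>u\<in>{0<..<q}. y u)"
      using best1_bounds[of q] q by (auto simp: y_def)
    note conds = value_bound_conditions[OF assms q, of "G q"]
    show "2 * real n * value_bound n q \<le> 2 * real n * value_bound n (q - 1)"
      "q + G q + (real q - 1) * (2 * real n * value_bound n q) \<le> q * (2 * real n * value_bound n (q - 1))"
      "G q \<le> 2 * real n * value_bound n q"
      using conds G_le[of q] q by (auto intro!: mult_left_mono)
  qed (simp add: y_def sum_prob_end1)
  also have "(\<Sum>q\<in>{0<..n}. q * best1 q + G q * y q) = (\<Sum>q\<in>{0<..n}. q * best1 q + S q)"
    by (rule sum.cong) (auto simp: S_eq)
  also have "\<dots> = 2 * n * (\<Sum>q\<in>{0<..n}. prob_order n (\<lambda>\<sigma>. stop1 q \<sigma> \<and> \<sigma> (q - 1) = 0)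
      + (\<Sum>j\<in>{0<..n}. prob_order n (\<lambda>\<sigma>. stop2 q j \<sigma> \<and> \<sigma> (n + j - 1) = 0)))"
    unfolding sum_distrib_left distrib_left S_def
    by (intro sum.cong arg_cong2[of _ _ _ _ "(+)"]) (auto simp: win1[symmetric] win2[symmetric] simp del: of_nat_add)
  also have "value_bound n 0 = 0.50195"
    using pos by (simp add: value_bound_def)
  finally show ?thesis using pos by (simp add: field_simps)
qed

end

section \<open>From winning probability to reward\<close>

lemma accepted_value_hard_instance:
  assumes "0 < n" "i < 2 * n"
  shows "0 \<le> accepted_value (hard_instance n) (Some i)"
    "accepted_value (hard_instance n) (Some i) \<le> of_bool (i = 0) + 1 / (2 * n)"
  using assms hard_instance_small[of i n] hard_instance_nonneg[of i n] hard_instance_0[of n]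
  by (auto simp: accepted_value_def)

lemma arrival_order_less: "\<sigma> \<in> arrival_orders n \<Longrightarrow> t < 2 * n \<Longrightarrow> \<sigma> t < 2 * n"
  using permutes_in_image[of \<sigma> "{..<2 * n}" t] by (simp add: arrival_orders_def)

lemma prob_order_eq_sum:
  "prob_order n Q = (\<Sum>\<sigma>\<in>arrival_orders n. of_bool (Q \<sigma>)) / card (arrival_orders n)"
  by (simp add: prob_order_def Collect_conj_eq)

context hard_run
begin

lemma phase1_result:
  fixes acc
  defines "acc \<equiv> \<lambda>xs. fst s (ranks1 (\<rho> n (hard_instance n)) xs)"
  assumes "\<sigma> \<in> arrival_orders n"
  obtains q c where "0 < q" "q \<le> n" "end1 q \<sigma>"
    "run_phase acc [] (map \<sigma> [0..<n]) = (map \<sigma> [0..<q], c)"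
    "0 \<le> accepted_value (hard_instance n) c"
    "accepted_value (hard_instance n) c \<le> of_bool (stop1 q \<sigma> \<and> \<sigma> (q - 1) = 0) + 1 / (2 * n)"
proof -
  have accept1: "accept1 q \<sigma> \<longleftrightarrow> acc (map \<sigma> [0..<q])" for q
    by (simp add: accept1_def ranks_at1_def acc_def)
  have take: "[] @ take j (map \<sigma> [0..<n]) = map \<sigma> [0..<j]" if "j \<le> n" for j
    using that by (simp add: take_map)
  show thesis
  proof (rule run_phase_cases[of "map \<sigma> [0..<n]" acc "[]"])
    fix q
    assume q: "0 < q" "q \<le> length (map \<sigma> [0..<n])" "acc ([] @ take q (map \<sigma> [0..<n]))"
      "\<And>j. 0 < j \<Longrightarrow> j < q \<Longrightarrow> \<not> acc ([] @ take j (map \<sigma> [0..<n]))"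
      "run_phase acc [] (map \<sigma> [0..<n])
        = ([] @ take q (map \<sigma> [0..<n]), Some (map \<sigma> [0..<n] ! (q - 1)))"
    have le: "q \<le> n" using q(2) by simp
    have "\<not> accept1 j \<sigma>" if "0 < j" "j < q" for j
      using q(4)[OF that] take[of j] that le by (simp add: accept1)
    moreover have "accept1 q \<sigma>"
      using q(3) take[OF le] by (simp add: accept1)
    ultimately have stop: "stop1 q \<sigma>"
      by (simp add: stop1_def idle1_def)
    then have "end1 q \<sigma>" by (simp add: stop1_def end1_def)
    moreover have "run_phase acc [] (map \<sigma> [0..<n]) = (map \<sigma> [0..<q], Some (\<sigma> (q - 1)))"
      using q(1,5) le unfolding take[OF le] by simp
    moreover have "\<sigma> (q - 1) < 2 * n"
      using q(1) le arrival_order_less[OF assms(2), of "q - 1"] by simp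
    note accepted_value_hard_instance[OF pos this]
    ultimately show thesis
      using q(1) le stop by (intro that[of q "Some (\<sigma> (q - 1))"]) simp_all
  next
    assume r: "\<And>j. 0 < j \<Longrightarrow> j \<le> length (map \<sigma> [0..<n]) \<Longrightarrow> \<not> acc ([] @ take j (map \<sigma> [0..<n]))"
      "run_phase acc [] (map \<sigma> [0..<n]) = ([] @ map \<sigma> [0..<n], None)"
    have "\<not> accept1 j \<sigma>" if "0 < j" "j \<le> n" for j
      using r(1)[of j] take[of j] that by (simp add: accept1)
    then have "end1 n \<sigma>" by (simp add: end1_def idle1_def)
    then show thesis
      using r(2) pos by (intro that[of n None]) (simp_all add: accepted_value_def)
  qed
qed

lemma phase2_result:
  fixes acc and \<sigma> :: "nat \<Rightarrow> nat" and q
  defines "acc \<equiv> \<lambda>ys. snd s (ranks1 (\<rho> n (hard_instance n)) (map \<sigma> [0..<q]))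
        (ranks2 (\<rho> n (hard_instance n)) (map \<sigma> [0..<q]) ys)"
  assumes "\<sigma> \<in> arrival_orders n" "end1 q \<sigma>"
  obtains j bs c where "0 < j" "j \<le> n" "run_phase acc [] (map \<sigma> [n..<2 * n]) = (bs, c)"
    "0 \<le> accepted_value (hard_instance n) c"
    "accepted_value (hard_instance n) c \<le> of_bool (stop2 q j \<sigma> \<and> \<sigma> (n + j - 1) = 0) + 1 / (2 * n)"
proof -
  have accept2: "accept2 q j \<sigma> \<longleftrightarrow> acc (map \<sigma> [n..<n + j])" for j
    by (simp add: accept2_def ranks_at1_def acc_def)
  have take: "[] @ take j (map \<sigma> [n..<2 * n]) = map \<sigma> [n..<n + j]" if "j \<le> n" for j
    using that by (simp add: take_map)
  show thesis
  proof (rule run_phase_cases[of "map \<sigma> [n..<2 * n]" acc "[]"])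
    fix j
    assume j: "0 < j" "j \<le> length (map \<sigma> [n..<2 * n])" "acc ([] @ take j (map \<sigma> [n..<2 * n]))"
      "\<And>i. 0 < i \<Longrightarrow> i < j \<Longrightarrow> \<not> acc ([] @ take i (map \<sigma> [n..<2 * n]))"
      "run_phase acc [] (map \<sigma> [n..<2 * n])
        = ([] @ take j (map \<sigma> [n..<2 * n]), Some (map \<sigma> [n..<2 * n] ! (j - 1)))"
    have le: "j \<le> n" using j(2) by simp
    have "\<not> accept2 q i \<sigma>" if "0 < i" "i < j" for i
      using j(4)[OF that] take[of i] that le by (simp add: accept2)
    moreover have "accept2 q j \<sigma>"
      using j(3) take[OF le] by (simp add: accept2)
    ultimately have stop: "stop2 q j \<sigma>"
      using assms(3) by (simp add: stop2_def idle2_def)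
    have nth: "map \<sigma> [n..<2 * n] ! (j - 1) = \<sigma> (n + j - 1)"
      using j(1) le by (cases j) auto
    have "\<sigma> (n + j - 1) < 2 * n"
      using j(1) le arrival_order_less[OF assms(2), of "n + j - 1"] by simp
    from accepted_value_hard_instance[OF pos this] show thesis
      by (intro that[OF j(1) le j(5)[unfolded nth]]) (simp_all add: stop)
  next
    assume "run_phase acc [] (map \<sigma> [n..<2 * n]) = ([] @ map \<sigma> [n..<2 * n], None)"
    then show thesis
      \<comment> \<open>Nothing is accepted and the value is 0, so any \<open>j\<close> in range
        serves as witness.\<close>
      using pos by (intro that[of 1 "map \<sigma> [n..<2 * n]" None]) (simp_all add: accepted_value_def)
  qed
qed

lemma reward_bounds:
  assumes "\<sigma> \<in> arrival_orders n"
  shows "0 \<le> reward \<rho> n (hard_instance n) \<sigma> s"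
    and "reward \<rho> n (hard_instance n) \<sigma> s
      \<le> (\<Sum>q\<in>{0<..n}. of_bool (stop1 q \<sigma> \<and> \<sigma> (q - 1) = 0)
            + (\<Sum>j\<in>{0<..n}. of_bool (stop2 q j \<sigma> \<and> \<sigma> (n + j - 1) = 0))) + 1 / n"
proof -
  let ?f = "\<lambda>q j. of_bool (stop2 q j \<sigma> \<and> \<sigma> (n + j - 1) = 0) :: real"
  let ?g = "\<lambda>q. of_bool (stop1 q \<sigma> \<and> \<sigma> (q - 1) = 0) :: real"
  obtain q c1 where q: "0 < q" "q \<le> n" "end1 q \<sigma>"
    "run_phase (\<lambda>xs. fst s (ranks1 (\<rho> n (hard_instance n)) xs)) [] (map \<sigma> [0..<n]) = (map \<sigma> [0..<q], c1)"
    "0 \<le> accepted_value (hard_instance n) c1"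
    "accepted_value (hard_instance n) c1 \<le> ?g q + 1 / (2 * n)"
    using phase1_result[OF assms] by metis
  obtain j bs c2 where j: "0 < j" "j \<le> n"
    "run_phase (\<lambda>ys. snd s (ranks1 (\<rho> n (hard_instance n)) (map \<sigma> [0..<q]))
        (ranks2 (\<rho> n (hard_instance n)) (map \<sigma> [0..<q]) ys)) [] (map \<sigma> [n..<2 * n]) = (bs, c2)"
    "0 \<le> accepted_value (hard_instance n) c2"
    "accepted_value (hard_instance n) c2 \<le> ?f q j + 1 / (2 * n)"
    using phase2_result[OF assms q(3)] by metis
  have reward: "reward \<rho> n (hard_instance n) \<sigma> s
      = accepted_value (hard_instance n) c1 + accepted_value (hard_instance n) c2"
    by (simp add: reward_def q(4) j(3))
  show "0 \<le> reward \<rho> n (hard_instance n) \<sigma> s" using q(5) j(4) by (simp add: reward)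
  have "?f q j \<le> (\<Sum>j\<in>{0<..n}. ?f q j)"
    using j(1,2) by (intro member_le_sum[of j _ "?f q"]) auto
  then have "?g q + ?f q j \<le> ?g q + (\<Sum>j\<in>{0<..n}. ?f q j)" by simp
  also have "\<dots> \<le> (\<Sum>q\<in>{0<..n}. ?g q + (\<Sum>j\<in>{0<..n}. ?f q j))"
    using q(1,2) by (intro member_le_sum[of q _ "\<lambda>q. ?g q + (\<Sum>j\<in>{0<..n}. ?f q j)"])
      (auto intro!: add_nonneg_nonneg sum_nonneg)
  finally show "reward \<rho> n (hard_instance n) \<sigma> s
      \<le> (\<Sum>q\<in>{0<..n}. ?g q + (\<Sum>j\<in>{0<..n}. ?f q j)) + 1 / n"
    using q(6) j(5) by (simp add: reward)
qed

lemma mean_reward_bound: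
  assumes "100000 \<le> n"
  shows "(\<Sum>\<sigma>\<in>arrival_orders n. reward \<rho> n (hard_instance n) \<sigma> s) / card (arrival_orders n) \<le> 0.502"
proof -
  let ?A = "arrival_orders n"
  let ?f = "\<lambda>\<sigma> q j. of_bool (stop2 q j \<sigma> \<and> \<sigma> (n + j - 1) = 0) :: real"
  let ?g = "\<lambda>\<sigma> q. of_bool (stop1 q \<sigma> \<and> \<sigma> (q - 1) = 0) :: real"
  have "(\<Sum>\<sigma>\<in>?A. reward \<rho> n (hard_instance n) \<sigma> s) / card ?A
      \<le> (\<Sum>\<sigma>\<in>?A. (\<Sum>q\<in>{0<..n}. ?g \<sigma> q + (\<Sum>j\<in>{0<..n}. ?f \<sigma> q j)) + 1 / n) / card ?A"
    by (intro divide_right_mono sum_mono reward_bounds) auto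
  also have "\<dots> = (\<Sum>\<sigma>\<in>?A. \<Sum>q\<in>{0<..n}. ?g \<sigma> q + (\<Sum>j\<in>{0<..n}. ?f \<sigma> q j)) / card ?A + 1 / n"
    using card_arrival_orders_pos[of n] by (simp add: sum.distrib add_divide_distrib)
  also have "(\<Sum>\<sigma>\<in>?A. \<Sum>q\<in>{0<..n}. ?g \<sigma> q + (\<Sum>j\<in>{0<..n}. ?f \<sigma> q j)) / card ?A
      = (\<Sum>q\<in>{0<..n}. prob_order n (\<lambda>\<sigma>. stop1 q \<sigma> \<and> \<sigma> (q - 1) = 0)
      + (\<Sum>j\<in>{0<..n}. prob_order n (\<lambda>\<sigma>. stop2 q j \<sigma> \<and> \<sigma> (n + j - 1) = 0)))"
    unfolding prob_order_eq_sum sum_divide_distrib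
    by (subst sum.swap, rule sum.cong[OF refl])
      (simp only: add_divide_distrib sum.distrib sum_divide_distrib, subst sum.swap, rule refl)
  also have "\<dots> \<le> 0.50195" using win_probability_bound[OF assms] .
  also have "1 / real n \<le> 0.00001" using assms by (simp add: field_simps)
  also have "0.50195 + 0.00001 \<le> (0.502 :: real)" by simp
  finally show ?thesis by simp
qed

end

section \<open>Randomized algorithms and the limit\<close>

lemma expectation_pair_le:
  fixes f :: "'a \<times> 'b \<Rightarrow> real"
  assumes "finite (set_pmf A)" "0 \<le> C" "\<And>a b. a \<in> set_pmf A \<Longrightarrow> 0 \<le> f (a, b)"
    and "\<And>b. measure_pmf.expectation A (\<lambda>a. f (a, b)) \<le> C"
  shows "measure_pmf.expectation (pair_pmf A B) f \<le> C"
proof (rule integral_real_bounded[OF assms(2)])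
  \<comment> \<open>The support of \<open>B\<close> may be infinite; nonnegative integrals can be
    iterated without first proving \<open>f\<close> integrable.\<close>
  have "(\<integral>\<^sup>+x. ennreal (f x) \<partial>pair_pmf A B) = (\<integral>\<^sup>+b. \<integral>\<^sup>+a. ennreal (f (a, b)) \<partial>A \<partial>B)"
    by (subst pair_commute_pmf, subst nn_integral_map_pmf, subst nn_integral_pair_pmf') simp
  also have "\<dots> \<le> (\<integral>\<^sup>+b. ennreal C \<partial>B)"
  proof (rule nn_integral_mono)
    fix b
    have "(\<integral>\<^sup>+a. ennreal (f (a, b)) \<partial>A) = ennreal (measure_pmf.expectation A (\<lambda>a. f (a, b)))"
      using assms(1,3)
      by (intro nn_integral_eq_integral integrable_measure_pmf_finite) (auto simp: AE_measure_pmf_iff)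
    then show "(\<integral>\<^sup>+a. ennreal (f (a, b)) \<partial>A) \<le> ennreal C"
      using assms(4)[of b] by (simp add: ennreal_leI)
  qed
  also have "\<dots> = ennreal C" by simp
  finally show "(\<integral>\<^sup>+x. ennreal (f x) \<partial>pair_pmf A B) \<le> ennreal C" .
qed

lemma expected_reward_hard_instance:
  assumes "valid_ranking_rule \<rho>" "100000 \<le> n"
  shows "expected_reward \<rho> ALG n (hard_instance n) \<le> 0.502"
  unfolding expected_reward_def
proof (rule expectation_pair_le)
  have run: "hard_run \<rho> n" using assms by unfold_locales auto
  fix \<sigma> s
  show "finite (set_pmf (pmf_of_set (arrival_orders n)))" by simp
  show "0 \<le> (case (\<sigma>, s) of (\<sigma>, s) \<Rightarrow> reward \<rho> n (hard_instance n) \<sigma> s)"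
    if "\<sigma> \<in> set_pmf (pmf_of_set (arrival_orders n))"
    using hard_run.reward_bounds(1)[OF run] that by simp
  show "measure_pmf.expectation (pmf_of_set (arrival_orders n))
      (\<lambda>\<sigma>. case (\<sigma>, s) of (\<sigma>, s) \<Rightarrow> reward \<rho> n (hard_instance n) \<sigma> s) \<le> 0.502"
    using hard_run.mean_reward_bound[OF run assms(2), of s] by (simp add: integral_pmf_of_set)
qed simp

lemma expected_optimum_hard_instance:
  assumes "0 < n"
  shows "1 \<le> expected_optimum n (hard_instance n)"
proof -
  let ?v = "hard_instance n"
  let ?opt = "\<lambda>\<sigma>. Max ((\<lambda>i. ?v ! \<sigma> i) ` {..<n}) + Max ((\<lambda>i. ?v ! \<sigma> i) ` {n..<2 * n})"
  have opt: "1 \<le> ?opt \<sigma>" if \<sigma>: "\<sigma> \<in> arrival_orders n" for \<sigma>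
  proof -
    have le_Max: "?v ! \<sigma> i \<le> Max ((\<lambda>i. ?v ! \<sigma> i) ` I)" if "finite I" "i \<in> I" for i I
      using that by (intro Max_ge) auto
    have nonneg: "0 \<le> ?v ! \<sigma> i" if "i < 2 * n" for i
      using arrival_order_less[OF \<sigma> that] by (rule hard_instance_nonneg)
    have "0 \<in> \<sigma> ` {..<2 * n}"
      using \<sigma> assms by (simp add: arrival_orders_def permutes_image)
    then obtain p where p: "p < 2 * n" "\<sigma> p = 0" by auto
    have 1: "?v ! \<sigma> p = 1" using p assms by (simp add: hard_instance_0)
    show ?thesis
    proof (cases "p < n")
      case True
      have "0 \<le> Max ((\<lambda>i. ?v ! \<sigma> i) ` {n..<2 * n})"
        using order_trans[OF nonneg[of n] le_Max[of "{n..<2 * n}" n]] assms by simp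
      moreover have "1 \<le> Max ((\<lambda>i. ?v ! \<sigma> i) ` {..<n})"
        using le_Max[of "{..<n}" p] True 1 by simp
      ultimately show ?thesis by linarith
    next
      case False
      have "0 \<le> Max ((\<lambda>i. ?v ! \<sigma> i) ` {..<n})"
        using order_trans[OF nonneg[of 0] le_Max[of "{..<n}" 0]] assms by simp
      moreover have "1 \<le> Max ((\<lambda>i. ?v ! \<sigma> i) ` {n..<2 * n})"
        using le_Max[of "{n..<2 * n}" p] False p(1) 1 by simp
      ultimately show ?thesis by linarith
    qed
  qed
  have "real (card (arrival_orders n)) = (\<Sum>\<sigma>\<in>arrival_orders n. 1)" by simp
  also have "\<dots> \<le> (\<Sum>\<sigma>\<in>arrival_orders n. ?opt \<sigma>)"
    using opt by (rule sum_mono)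
  finally show ?thesis
    using card_arrival_orders_pos[of n]
    by (simp add: expected_optimum_def integral_pmf_of_set pos_le_divide_eq)
qed

lemma perf_le:
  assumes "valid_ranking_rule \<rho>"
  shows "perf \<rho> ALG \<le> ereal 0.502"
  unfolding perf_def
proof (rule Liminf_le)
  show "\<forall>\<^sub>F n in sequentially. (INF v \<in> {v \<in> instances n. \<exists>x\<in>set v. x \<noteq> 0}.
      ereal (expected_reward \<rho> ALG n v / expected_optimum n v)) \<le> ereal 0.502"
    using eventually_ge_at_top[of 100000]
  proof eventually_elim
    case (elim n)
    let ?v = "hard_instance n"
    have n: "0 < n" using elim by simp
    have "?v ! 0 \<in> set ?v" using n by (intro nth_mem) simp
    then have "?v \<in> {v \<in> instances n. \<exists>x\<in>set v. x \<noteq> 0}"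
      using hard_instance_in_instances[of n] hard_instance_0[OF n] by force
    moreover have "expected_reward \<rho> ALG n ?v / expected_optimum n ?v \<le> 0.502"
    proof -
      have "expected_reward \<rho> ALG n ?v \<le> 0.502 * 1"
        using expected_reward_hard_instance[OF assms elim] by simp
      also have "\<dots> \<le> 0.502 * expected_optimum n ?v"
        using expected_optimum_hard_instance[OF n] by (intro mult_left_mono) auto
      finally show ?thesis
        using expected_optimum_hard_instance[OF n] by (simp add: pos_divide_le_eq)
    qed
    ultimately show ?case by (intro INF_lower2) auto
  qed
qed simp

theorem theorem2p4:
  fixes \<rho> :: ranking_rule
  assumes "valid_ranking_rule \<rho>"
  shows "(\<forall>ALG :: value_oblivious_alg. perf_oblivious \<rho> ALG \<le> ereal 0.502)
    \<and> (\<forall>ALG :: value_observed_alg. perf \<rho> ALG \<le> ereal 0.502)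
    \<and> (SUP ALG :: value_oblivious_alg. perf_oblivious \<rho> ALG) \<le> ereal 0.502
    \<and> (SUP ALG :: value_observed_alg. perf \<rho> ALG) \<le> ereal 0.502"
  using perf_le[OF assms] by (auto intro: SUP_least)

end
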